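(* Let $\mathfrak R=\mathfrak C[\theta^1,\dots,\theta^q]^\pm=\bigwedge_{\mathfrak C}(\theta^1,\dots,\theta^q)$ be a split $C^\infty$-superring and let $E_\theta=\sum_{i=1}^q\theta^i\frac{\partial}{\partial\theta^i}$ be the Euler vector field associated with the basis $\{\theta^i\}$. Then every homogeneous element $a\in\mathfrak R$ of degree $k$ is an eigenvector of $E_\theta$ with weight $k$, that is, $E_\theta(a)=k\,a$.
   Context: A $C^\infty$-ring is a set $\mathfrak C$ with operations $\phi_f:\mathfrak C^n\to\mathfrak C$ for all $f\in C^\infty(\mathbb R^n)$, $n\in\mathbb N$, preserving coordinate projections and compositions of smooth functions; it is in particular a commutative $\mathbb R$-algebra. For a free $\mathfrak C$-module with finite basis $\theta^1,\dots,\theta^q$, $\mathfrak C[\theta^1,\dots,\theta^q]^\pm$ is its exterior algebra over $\mathfrak C$, viewed as a superring ($\mathbb Z_2$-graded supercommutative) with the $\theta^i$ odd; $C^\infty$-superrings isomorphic to one of this form are called split. A homogeneous element of degree $k$ is a $\mathfrak C$-linear combination of products $\theta^{i_1}\cdots\theta^{i_k}$ with $i_1<\dots<i_k$. The odd derivation $\frac{\partial}{\partial\theta^i}$ is the $\mathbb R$-linear map determined by $\frac{\partial}{\partial\theta^i}(c)=0$ for $c\in\mathfrak C$, $\frac{\partial}{\partial\theta^i}(\theta^j)=\delta_i^j$, and the graded Leibniz rule $D(rs)=D(r)s+(-1)^{|D||r|}rD(s)$ for homogeneous $r,s$. An element $a$ has weight $k$ if $E_\theta(a)=k\,a$. *)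

theory Defs
  imports "HOL-Analysis.Function_Topology" "HOL-Algebra.QuotRing"
begin

section \<open>Smooth functions of $n$ real variables\<close>

text \<open>
  A function on $\mathbb{R}^n$ is encoded as a function of an infinite sequence
  of reals that depends on the coordinates $1,\dots,n$ only. For such functions, continuity in the
  product topology on \<^typ>\<open>nat \<Rightarrow> real\<close> is continuity on $\mathbb{R}^n$.
\<close>

primrec Ck_fun :: "nat \<Rightarrow> nat \<Rightarrow> ((nat \<Rightarrow> real) \<Rightarrow> real) \<Rightarrow> bool" where
  "Ck_fun n 0 f \<longleftrightarrow> continuous_on UNIV f"
| "Ck_fun n (Suc k) f \<longleftrightarrow> continuous_on UNIV f \<and>
     (\<forall>i\<in>{1..n}. \<exists>g. (\<forall>x. ((\<lambda>t. f (x(i := t))) has_real_derivative g x) (at (x i)))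
                    \<and> Ck_fun n k g)"

definition smooth_fun :: "nat \<Rightarrow> ((nat \<Rightarrow> real) \<Rightarrow> real) \<Rightarrow> bool" where
  "smooth_fun n f \<longleftrightarrow>
     (\<forall>x y. (\<forall>i\<in>{1..n}. x i = y i) \<longrightarrow> f x = f y) \<and> (\<forall>k. Ck_fun n k f)"


section \<open>$C^\infty$-rings\<close>

text \<open>
  The component \<open>cinf_op C n f\<close> is the operation $\phi_f : C^n \to C$. As above, an $n$-tuple is
  a sequence of which only the entries $1,\dots,n$ matter; this is the assumption \<open>op_cong\<close>.
  The case $n = 0$ is included and supplies the real constants.
\<close>

record 'a cinf_ring = "'a partial_object" +
  cinf_op :: "nat \<Rightarrow> ((nat \<Rightarrow> real) \<Rightarrow> real) \<Rightarrow> (nat \<Rightarrow> 'a) \<Rightarrow> 'a"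

locale cinf_ring =
  fixes C :: "'a cinf_ring"
  assumes op_closed:
      "\<lbrakk>smooth_fun n f; \<And>i. i \<in> {1..n} \<Longrightarrow> x i \<in> carrier C\<rbrakk> \<Longrightarrow> cinf_op C n f x \<in> carrier C"
    and op_cong:
      "\<lbrakk>smooth_fun n f; \<And>i. i \<in> {1..n} \<Longrightarrow> x i \<in> carrier C; \<And>i. i \<in> {1..n} \<Longrightarrow> x i = y i\<rbrakk>
        \<Longrightarrow> cinf_op C n f x = cinf_op C n f y"
    and op_proj:
      "\<lbrakk>j \<in> {1..n}; \<And>i. i \<in> {1..n} \<Longrightarrow> x i \<in> carrier C\<rbrakk> \<Longrightarrow> cinf_op C n (\<lambda>y. y j) x = x j"
    and op_comp:
      "\<lbrakk>smooth_fun m f; \<And>j. j \<in> {1..m} \<Longrightarrow> smooth_fun n (g j);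
        \<And>i. i \<in> {1..n} \<Longrightarrow> x i \<in> carrier C\<rbrakk>
        \<Longrightarrow> cinf_op C m f (\<lambda>j. cinf_op C n (g j) x) = cinf_op C n (\<lambda>y. f (\<lambda>j. g j y)) x"

definition cinf_const :: "'a cinf_ring \<Rightarrow> real \<Rightarrow> 'a" where
  "cinf_const C r = cinf_op C 0 (\<lambda>_. r) undefined"

definition underlying_ring :: "'a cinf_ring \<Rightarrow> 'a ring" where
  "underlying_ring C =
     \<lparr>carrier = carrier C,
      mult = (\<lambda>a b. cinf_op C 2 (\<lambda>y. y 1 * y 2) (\<lambda>i. if i = 1 then a else b)),
      one = cinf_const C 1,
      zero = cinf_const C 0,
      add = (\<lambda>a b. cinf_op C 2 (\<lambda>y. y 1 + y 2) (\<lambda>i. if i = 1 then a else b))\<rparr>"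


section \<open>The exterior algebra of a free module with a finite basis\<close>

text \<open>
  The tensor algebra of the free module on $\theta^1,\dots,\theta^q$ is the algebra of
  noncommutative polynomials: finitely supported coefficient functions on words over
  \<open>{1..q}\<close>, multiplied by concatenation of words. The exterior algebra is its quotient by the
  two-sided ideal generated by the squares $v \otimes v$ of the elements $v$ of the module.
\<close>

definition tensor_algebra :: "('a, 'm) ring_scheme \<Rightarrow> nat \<Rightarrow> (nat list \<Rightarrow> 'a) ring" where
  "tensor_algebra K q =
     \<lparr>carrier = {f. (\<forall>w. f w \<in> carrier K) \<and> finite {w. f w \<noteq> \<zero>\<^bsub>K\<^esub>}
                    \<and> (\<forall>w. w \<notin> lists {1..q} \<longrightarrow> f w = \<zero>\<^bsub>K\<^esub>)},
      mult = (\<lambda>f g w. \<Oplus>\<^bsub>K\<^esub>l\<in>{..length w}. f (take l w) \<otimes>\<^bsub>K\<^esub> g (drop l w)),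
      one = (\<lambda>w. if w = [] then \<one>\<^bsub>K\<^esub> else \<zero>\<^bsub>K\<^esub>),
      zero = (\<lambda>w. \<zero>\<^bsub>K\<^esub>),
      add = (\<lambda>f g w. f w \<oplus>\<^bsub>K\<^esub> g w)\<rparr>"

definition tensor_monom :: "('a, 'm) ring_scheme \<Rightarrow> 'a \<Rightarrow> nat list \<Rightarrow> nat list \<Rightarrow> 'a" where
  "tensor_monom K c w = (\<lambda>u. if u = w then c else \<zero>\<^bsub>K\<^esub>)"

definition exterior_ideal :: "('a, 'm) ring_scheme \<Rightarrow> nat \<Rightarrow> (nat list \<Rightarrow> 'a) set" where
  "exterior_ideal K q = Idl\<^bsub>tensor_algebra K q\<^esub>
     {v \<otimes>\<^bsub>tensor_algebra K q\<^esub> v | v.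
        v \<in> carrier (tensor_algebra K q) \<and> (\<forall>w. v w \<noteq> \<zero>\<^bsub>K\<^esub> \<longrightarrow> length w = 1)}"

definition exterior_algebra :: "('a, 'm) ring_scheme \<Rightarrow> nat \<Rightarrow> (nat list \<Rightarrow> 'a) set ring" where
  "exterior_algebra K q = tensor_algebra K q Quot exterior_ideal K q"

definition ext_scalar :: "('a, 'm) ring_scheme \<Rightarrow> nat \<Rightarrow> 'a \<Rightarrow> (nat list \<Rightarrow> 'a) set" where
  "ext_scalar K q c = exterior_ideal K q +>\<^bsub>tensor_algebra K q\<^esub> tensor_monom K c []"

definition ext_gen :: "('a, 'm) ring_scheme \<Rightarrow> nat \<Rightarrow> nat \<Rightarrow> (nat list \<Rightarrow> 'a) set" where
  "ext_gen K q i = exterior_ideal K q +>\<^bsub>tensor_algebra K q\<^esub> tensor_monom K \<one>\<^bsub>K\<^esub> [i]"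

definition ext_monom :: "('a, 'm) ring_scheme \<Rightarrow> nat \<Rightarrow> nat list \<Rightarrow> (nat list \<Rightarrow> 'a) set" where
  "ext_monom K q w =
     foldr (\<lambda>i x. ext_gen K q i \<otimes>\<^bsub>exterior_algebra K q\<^esub> x) w \<one>\<^bsub>exterior_algebra K q\<^esub>"

text \<open>Strictly increasing lists stand for the index tuples $i_1 < \dots < i_k$.\<close>

definition increasing_words :: "nat \<Rightarrow> nat list set" where
  "increasing_words q = {w \<in> lists {1..q}. sorted_wrt (<) w}"

definition ext_span :: "('a, 'm) ring_scheme \<Rightarrow> nat \<Rightarrow> nat list set \<Rightarrow> (nat list \<Rightarrow> 'a) set set" where
  "ext_span K q W =
     {\<Oplus>\<^bsub>exterior_algebra K q\<^esub>w\<in>W. ext_scalar K q (c w) \<otimes>\<^bsub>exterior_algebra K q\<^esub> ext_monom K q w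
      | c. c \<in> W \<rightarrow> carrier K}"

definition ext_homogeneous :: "('a, 'm) ring_scheme \<Rightarrow> nat \<Rightarrow> nat \<Rightarrow> (nat list \<Rightarrow> 'a) set set" where
  "ext_homogeneous K q k = ext_span K q {w \<in> increasing_words q. length w = k}"

text \<open>The even part (\<open>p = 0\<close>) and the odd part (\<open>p = 1\<close>) of the superring.\<close>

definition ext_parity :: "('a, 'm) ring_scheme \<Rightarrow> nat \<Rightarrow> nat \<Rightarrow> (nat list \<Rightarrow> 'a) set set" where
  "ext_parity K q p = ext_span K q {w \<in> increasing_words q. length w mod 2 = p mod 2}"


section \<open>Superderivations and the Euler vector field\<close>

definition split_superring :: "'a cinf_ring \<Rightarrow> nat \<Rightarrow> (nat list \<Rightarrow> 'a) set ring" where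
  "split_superring C q = exterior_algebra (underlying_ring C) q"

text \<open>
  Maps on the superring are taken to be extensional (\<open>\<rightarrow>\<^sub>E\<close>), so that a map is determined by
  its values on the carrier and the definite description below is meaningful.
\<close>

definition superderivation ::
    "'a cinf_ring \<Rightarrow> nat \<Rightarrow> nat \<Rightarrow> ((nat list \<Rightarrow> 'a) set \<Rightarrow> (nat list \<Rightarrow> 'a) set) \<Rightarrow> bool" where
  "superderivation C q d D \<longleftrightarrow>
     (let R = split_superring C q; K = underlying_ring C in
      D \<in> carrier R \<rightarrow>\<^sub>E carrier R \<and>
      (\<forall>r\<in>carrier R. \<forall>s\<in>carrier R. D (r \<oplus>\<^bsub>R\<^esub> s) = D r \<oplus>\<^bsub>R\<^esub> D s) \<and>
      (\<forall>t. \<forall>r\<in>carrier R. D (ext_scalar K q (cinf_const C t) \<otimes>\<^bsub>R\<^esub> r)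
                         = ext_scalar K q (cinf_const C t) \<otimes>\<^bsub>R\<^esub> D r) \<and>
      (\<forall>p. \<forall>r\<in>ext_parity K q p. D r \<in> ext_parity K q (d + p)) \<and>
      (\<forall>p p'. \<forall>r\<in>ext_parity K q p. \<forall>s\<in>ext_parity K q p'.
         D (r \<otimes>\<^bsub>R\<^esub> s) = (D r \<otimes>\<^bsub>R\<^esub> s) \<oplus>\<^bsub>R\<^esub> ([((-1)^(d * p) :: int)] \<cdot>\<^bsub>R\<^esub> (r \<otimes>\<^bsub>R\<^esub> D s))))"

definition ext_partial ::
    "'a cinf_ring \<Rightarrow> nat \<Rightarrow> nat \<Rightarrow> (nat list \<Rightarrow> 'a) set \<Rightarrow> (nat list \<Rightarrow> 'a) set" where
  "ext_partial C q i =
     (THE D. superderivation C q 1 D \<and>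
        (\<forall>c\<in>carrier C. D (ext_scalar (underlying_ring C) q c) = \<zero>\<^bsub>split_superring C q\<^esub>) \<and>
        (\<forall>j\<in>{1..q}. D (ext_gen (underlying_ring C) q j) =
           (if j = i then \<one>\<^bsub>split_superring C q\<^esub> else \<zero>\<^bsub>split_superring C q\<^esub>)))"

definition euler_field ::
    "'a cinf_ring \<Rightarrow> nat \<Rightarrow> (nat list \<Rightarrow> 'a) set \<Rightarrow> (nat list \<Rightarrow> 'a) set" where
  "euler_field C q a =
     (\<Oplus>\<^bsub>split_superring C q\<^esub>i\<in>{1..q}.
        ext_gen (underlying_ring C) q i \<otimes>\<^bsub>split_superring C q\<^esub> ext_partial C q i a)"

end

theory Submission
  imports Defs
begin

text \<open>
  On a monomial in distinct generators, $\theta^i\partial_i$ removes the factor $\theta^i$ and puts it back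
  with the same sign, or gives zero when $\theta^i$ does not occur. The sum over $i$ thus counts the
  factors. The substance lies in the partial derivatives themselves.

  \<^emph>\<open>The partial derivatives.\<close> The derivative \<open>ext_partial C q i\<close> is given by a definite description, so
  its existence and its uniqueness both have to be shown. For existence, let the contraction with
  the \<open>i\<close>-th dual basis vector act on the tensor algebra by
  \[ \theta^{j_1}\cdots\theta^{j_k} \mapsto
     \sum_{l} (-1)^{l-1} \delta_{i j_l}\, \theta^{j_1}\cdots\widehat{\theta^{j_l}}\cdots\theta^{j_k}. \]
  With $\sigma$ the grade involution, contraction satisfies $d(xy) = d(x)\,y + \sigma(x)\,d(y)$ for
  all tensors (\<open>contract_conv\<close>). It maps the defining ideal of the exterior algebra into itself: the
  tensors $x$ of the ideal for which $d(x)$ and $\sigma(x)$ lie in the ideal too form an ideal, and it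
  contains every square $v \otimes v$, because $\sigma(v \otimes v) = v \otimes v$ and
  $d(v \otimes v) = v_i v - v v_i = 0$ over a commutative ring (\<open>contract_ideal\<close>). Hence contraction
  descends to the exterior algebra, and there it is an odd superderivation with the prescribed values.
  For uniqueness, two superderivations of the same degree that agree on scalars and generators agree on
  every monomial by the Leibniz rule, hence everywhere (\<open>superderivation_eqI\<close>).

  The parts of given parity are defined through increasing words. The Leibniz rule is applied to
  products of arbitrary words, so it is needed that a monomial on any word is zero or, up to sign, a
  monomial on an increasing word of the same length (\<open>monomial_reorder\<close>). Then \<open>ext_parity\<close> and
  \<open>ext_homogeneous\<close> are the images of the tensors supported on words of the right lengths.

  \<^emph>\<open>The Euler field.\<close> Since $\theta^i\theta^j = -\theta^j\theta^i$, the Leibniz rule gives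
  $\theta^i\partial_i(\theta^j s) = \delta_{ij}\,\theta^i s + \theta^j\theta^i\partial_i(s)$, and summing
  over $i$ yields $E_\theta(\theta^j s) = \theta^j s + \theta^j E_\theta(s)$ (\<open>ext_euler_gen_mult\<close>).
  Each further generator thus raises the weight by one, so a monomial of degree $k$ has weight $k$,
  and additivity extends this to all homogeneous elements of degree $k$.
\<close>

section \<open>The commutative ring underlying a $C^\infty$-ring\<close>

text \<open>
  Needed for products: in the Leibniz rule $f'g + g'f$ the undifferentiated factors have one order of
  smoothness more than the induction hypothesis speaks of.
\<close>

lemma Ck_fun_pred: "Ck_fun n (Suc k) f \<Longrightarrow> Ck_fun n k f"
proof (induction k arbitrary: f)
  case 0
  then show ?case by simp
next
  case (Suc k)
  then show ?case by (metis Ck_fun.simps(2))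
qed

lemma Ck_fun_const: "Ck_fun n k (\<lambda>_. c)"
proof (induction k arbitrary: c)
  case (Suc k)
  have "\<exists>g. (\<forall>x. ((\<lambda>t. c) has_real_derivative g x) (at (x i))) \<and> Ck_fun n k g" for i :: nat
    by (intro exI[of _ "\<lambda>_. 0"]) (use Suc in auto)
  then show ?case by auto
qed auto

lemma Ck_fun_proj: "Ck_fun n k (\<lambda>y. y j)"
proof (cases k)
  case (Suc m)
  have "\<exists>g. (\<forall>x. ((\<lambda>t. (x(i := t)) j) has_real_derivative g x) (at (x i))) \<and> Ck_fun n m g" for i
  proof (cases "i = j")
    case True
    then show ?thesis
      by (intro exI[of _ "\<lambda>_. 1"]) (auto intro!: Ck_fun_const derivative_eq_intros)
  next
    case False
    then show ?thesis
      by (intro exI[of _ "\<lambda>_. 0"]) (auto intro!: Ck_fun_const)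
  qed
  then show ?thesis
    using Suc by (auto intro: continuous_on_product_coordinates)
qed (auto intro: continuous_on_product_coordinates)

lemma Ck_fun_add:
  assumes "Ck_fun n k f" "Ck_fun n k g"
  shows "Ck_fun n k (\<lambda>y. f y + g y)"
  using assms
proof (induction k arbitrary: f g)
  case 0
  then show ?case by (auto intro: continuous_on_add)
next
  case (Suc k)
  have "\<exists>h. (\<forall>x. ((\<lambda>t. f (x(i := t)) + g (x(i := t))) has_real_derivative h x) (at (x i)))
            \<and> Ck_fun n k h" if i: "i \<in> {1..n}" for i
  proof -
    from bspec[OF conjunct2[OF Suc.prems(1)[unfolded Ck_fun.simps]] i]
    obtain f' where f': "\<forall>x. ((\<lambda>t. f (x(i := t))) has_real_derivative f' x) (at (x i))" "Ck_fun n k f'"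
      by (elim exE conjE)
    from bspec[OF conjunct2[OF Suc.prems(2)[unfolded Ck_fun.simps]] i]
    obtain g' where g': "\<forall>x. ((\<lambda>t. g (x(i := t))) has_real_derivative g' x) (at (x i))" "Ck_fun n k g'"
      by (elim exE conjE)
    show ?thesis
      by (intro exI[of _ "\<lambda>x. f' x + g' x"] conjI allI DERIV_add Suc.IH f' [rule_format] g' [rule_format])
  qed
  with Suc.prems show ?case by (auto intro: continuous_on_add)
qed

lemma Ck_fun_mult:
  assumes "Ck_fun n k f" "Ck_fun n k g"
  shows "Ck_fun n k (\<lambda>y. f y * g y)"
  using assms
proof (induction k arbitrary: f g)
  case 0
  then show ?case by (auto intro: continuous_on_mult)
next
  case (Suc k)
  have "\<exists>h. (\<forall>x. ((\<lambda>t. f (x(i := t)) * g (x(i := t))) has_real_derivative h x) (at (x i)))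
            \<and> Ck_fun n k h" if i: "i \<in> {1..n}" for i
  proof -
    from bspec[OF conjunct2[OF Suc.prems(1)[unfolded Ck_fun.simps]] i]
    obtain f' where f': "\<forall>x. ((\<lambda>t. f (x(i := t))) has_real_derivative f' x) (at (x i))" "Ck_fun n k f'"
      by (elim exE conjE)
    from bspec[OF conjunct2[OF Suc.prems(2)[unfolded Ck_fun.simps]] i]
    obtain g' where g': "\<forall>x. ((\<lambda>t. g (x(i := t))) has_real_derivative g' x) (at (x i))" "Ck_fun n k g'"
      by (elim exE conjE)
    have "((\<lambda>t. f (x(i := t)) * g (x(i := t))) has_real_derivative f' x * g x + g' x * f x) (at (x i))"
      for x
      using DERIV_mult[OF f'(1)[rule_format] g'(1)[rule_format], of x x] by simp
    moreover have "Ck_fun n k (\<lambda>x. f' x * g x + g' x * f x)"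
      using Suc.prems[THEN Ck_fun_pred] f'(2) g'(2) by (intro Ck_fun_add Suc.IH)
    ultimately show ?thesis
      by (intro exI[of _ "\<lambda>x. f' x * g x + g' x * f x"] conjI allI)
  qed
  with Suc.prems show ?case by (auto intro: continuous_on_mult)
qed

lemma smooth_fun_const: "smooth_fun n (\<lambda>_. c)"
  by (simp add: smooth_fun_def Ck_fun_const)

lemma smooth_fun_proj: "j \<in> {1..n} \<Longrightarrow> smooth_fun n (\<lambda>y. y j)"
  by (auto simp: smooth_fun_def Ck_fun_proj)

lemma smooth_fun_add: "smooth_fun n f \<Longrightarrow> smooth_fun n g \<Longrightarrow> smooth_fun n (\<lambda>y. f y + g y)"
  unfolding smooth_fun_def by (metis (no_types, lifting) Ck_fun_add)

lemma smooth_fun_mult: "smooth_fun n f \<Longrightarrow> smooth_fun n g \<Longrightarrow> smooth_fun n (\<lambda>y. f y * g y)"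
  unfolding smooth_fun_def by (metis (no_types, lifting) Ck_fun_mult)

context cinf_ring
begin

abbreviation K where "K \<equiv> underlying_ring C"

lemma carrier_underlying: "carrier K = carrier C"
  by (simp add: underlying_ring_def)

lemma op_in_carrier:
  "smooth_fun n f \<Longrightarrow> x \<in> {1..n} \<rightarrow> carrier C \<Longrightarrow> cinf_op C n f x \<in> carrier C"
  by (rule op_closed) auto

text \<open>
  The argument list of a binary operation is a sequence that is constant from the second entry on,
  whereas composition of operations wants a family of smooth functions; this matches the two.
\<close>

lemma op_binary:
  assumes f: "smooth_fun 2 f" and g: "smooth_fun n g" and h: "smooth_fun n h"
    and x: "x \<in> {1..n} \<rightarrow> carrier C"
  shows "cinf_op C 2 f (\<lambda>i. if i = 1 then cinf_op C n g x else cinf_op C n h x)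
       = cinf_op C n (\<lambda>y. f (\<lambda>i. if i = 1 then g y else h y)) x"
proof -
  let ?g = "\<lambda>i::nat. if i = 1 then g else h"
  have "cinf_op C 2 f (\<lambda>j. cinf_op C n (?g j) x) = cinf_op C n (\<lambda>y. f (\<lambda>j. ?g j y)) x"
    by (rule op_comp) (use assms in auto)
  then show ?thesis
    by (simp add: if_distrib[of "\<lambda>g. cinf_op C n g x"] if_distrib[of "\<lambda>g. g _"] cong: if_cong)
qed

text \<open>
  With \<open>op_mult\<close> and \<open>op_const\<close> below: on elements obtained by applying smooth functions to a
  common tuple, the ring operations are the pointwise operations on those functions.
\<close>

lemma op_add:
  assumes "smooth_fun n g" "smooth_fun n h" "x \<in> {1..n} \<rightarrow> carrier C"
  shows "cinf_op C n g x \<oplus>\<^bsub>K\<^esub> cinf_op C n h x = cinf_op C n (\<lambda>y. g y + h y) x"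
  using op_binary[OF _ assms, where f = "\<lambda>y. y 1 + y 2"]
  by (simp add: underlying_ring_def smooth_fun_add smooth_fun_proj)

lemma op_mult:
  assumes "smooth_fun n g" "smooth_fun n h" "x \<in> {1..n} \<rightarrow> carrier C"
  shows "cinf_op C n g x \<otimes>\<^bsub>K\<^esub> cinf_op C n h x = cinf_op C n (\<lambda>y. g y * h y) x"
  using op_binary[OF _ assms, where f = "\<lambda>y. y 1 * y 2"]
  by (simp add: underlying_ring_def smooth_fun_mult smooth_fun_proj)

text \<open>
  Constants are nullary operations evaluated at an unspecified tuple. Composing with the empty family
  of functions moves them to any tuple.
\<close>

lemma op_const:
  assumes "x \<in> {1..n} \<rightarrow> carrier C"
  shows "cinf_const C r = cinf_op C n (\<lambda>_. r) x"
proof -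
  have "cinf_op C 0 (\<lambda>_. r) undefined = cinf_op C 0 (\<lambda>_. r) (\<lambda>j. cinf_op C n (\<lambda>_. 0) x)"
    by (rule op_cong) (auto simp: smooth_fun_const)
  also have "\<dots> = cinf_op C n (\<lambda>_. r) x"
    using assms by (intro op_comp[of 0 "\<lambda>_. r" n "\<lambda>_ _. 0" x]) (auto simp: smooth_fun_const)
  finally show ?thesis by (simp add: cinf_const_def)
qed

lemma const_closed: "cinf_const C r \<in> carrier K"
  unfolding cinf_const_def carrier_underlying by (rule op_closed) (auto simp: smooth_fun_const)

text \<open>
  Any three elements are the values of the three coordinate functions at one tuple. Every ring axiom
  thereby becomes an identity between polynomial functions on $\mathbb{R}^3$, which holds in
  $\mathbb{R}$.
\<close>

lemma cring_underlying_ring: "cring K"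
proof -
  have coordinates: "\<exists>x. x \<in> {1..3} \<rightarrow> carrier C \<and> a = cinf_op C 3 (\<lambda>y. y 1) x
      \<and> b = cinf_op C 3 (\<lambda>y. y 2) x \<and> c = cinf_op C 3 (\<lambda>y. y 3) x"
    if "a \<in> carrier K" "b \<in> carrier K" "c \<in> carrier K" for a b c
  proof (intro exI conjI)
    let ?x = "\<lambda>i::nat. if i = 1 then a else if i = 2 then b else c"
    show x: "?x \<in> {1..3} \<rightarrow> carrier C"
      using that by (simp add: carrier_underlying)
    have "cinf_op C 3 (\<lambda>y. y j) ?x = ?x j" if "j \<in> {1..3}" for j
      using that x by (intro op_proj) (auto simp: Pi_iff)
    from this[of 1] this[of 2] this[of 3]
    show "a = cinf_op C 3 (\<lambda>y. y 1) ?x" "b = cinf_op C 3 (\<lambda>y. y 2) ?x" "c = cinf_op C 3 (\<lambda>y. y 3) ?x"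
      by simp_all
  qed
  have one: "\<one>\<^bsub>K\<^esub> = cinf_const C 1" and zero: "\<zero>\<^bsub>K\<^esub> = cinf_const C 0"
    by (simp_all add: underlying_ring_def)
  note smooth = smooth_fun_proj smooth_fun_add smooth_fun_mult smooth_fun_const
  have ab: "abelian_group K"
  proof (rule abelian_groupI)
    fix a b assume "a \<in> carrier K" "b \<in> carrier K"
    then obtain x where x: "x \<in> {1..3} \<rightarrow> carrier C"
      "a = cinf_op C 3 (\<lambda>y. y 1) x" "b = cinf_op C 3 (\<lambda>y. y 2) x" using coordinates by blast
    show "a \<oplus>\<^bsub>K\<^esub> b = b \<oplus>\<^bsub>K\<^esub> a"
      unfolding x(2,3) by (simp add: op_add[OF _ _ x(1)] smooth add.commute)
    show "a \<oplus>\<^bsub>K\<^esub> b \<in> carrier K"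
      unfolding x(2,3) carrier_underlying by (simp add: op_add[OF _ _ x(1)] op_in_carrier[OF _ x(1)] smooth)
  next
    fix a b c assume "a \<in> carrier K" "b \<in> carrier K" "c \<in> carrier K"
    then obtain x where x: "x \<in> {1..3} \<rightarrow> carrier C"
      "a = cinf_op C 3 (\<lambda>y. y 1) x" "b = cinf_op C 3 (\<lambda>y. y 2) x" "c = cinf_op C 3 (\<lambda>y. y 3) x"
      using coordinates by blast
    show "a \<oplus>\<^bsub>K\<^esub> b \<oplus>\<^bsub>K\<^esub> c = a \<oplus>\<^bsub>K\<^esub> (b \<oplus>\<^bsub>K\<^esub> c)"
      unfolding x(2-) by (simp add: op_add[OF _ _ x(1)] smooth add.assoc)
  next
    fix a assume "a \<in> carrier K"
    then obtain x where x: "x \<in> {1..3} \<rightarrow> carrier C" "a = cinf_op C 3 (\<lambda>y. y 1) x"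
      using coordinates by blast
    show "\<zero>\<^bsub>K\<^esub> \<oplus>\<^bsub>K\<^esub> a = a"
      unfolding x(2-) zero by (simp add: op_add[OF _ _ x(1)] smooth op_const[OF x(1)])
    \<comment> \<open>The additive inverse is the operation of the smooth function $y \mapsto -y$, written as a product so
      that smoothness follows from that of constants and coordinates.\<close>
    have "cinf_op C 3 (\<lambda>y. - 1 * y 1) x \<oplus>\<^bsub>K\<^esub> a = cinf_op C 3 (\<lambda>y. - 1 * y 1 + y 1) x"
      unfolding x(2) by (rule op_add) (intro smooth x(1) | simp)+
    then have "cinf_op C 3 (\<lambda>y. - 1 * y 1) x \<oplus>\<^bsub>K\<^esub> a = \<zero>\<^bsub>K\<^esub>"
      by (simp add: zero op_const[OF x(1)])
    moreover have "cinf_op C 3 (\<lambda>y. - 1 * y 1) x \<in> carrier K"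
      unfolding carrier_underlying by (rule op_in_carrier) (intro smooth x(1) | simp)+
    ultimately show "\<exists>b\<in>carrier K. b \<oplus>\<^bsub>K\<^esub> a = \<zero>\<^bsub>K\<^esub>" by blast
  qed (simp add: zero const_closed)
  have mon: "comm_monoid K"
  proof (rule comm_monoidI)
    fix a b assume "a \<in> carrier K" "b \<in> carrier K"
    then obtain x where x: "x \<in> {1..3} \<rightarrow> carrier C"
      "a = cinf_op C 3 (\<lambda>y. y 1) x" "b = cinf_op C 3 (\<lambda>y. y 2) x" using coordinates by blast
    show "a \<otimes>\<^bsub>K\<^esub> b = b \<otimes>\<^bsub>K\<^esub> a"
      unfolding x(2,3) by (simp add: op_mult[OF _ _ x(1)] smooth mult.commute)
    show "a \<otimes>\<^bsub>K\<^esub> b \<in> carrier K"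
      unfolding x(2,3) carrier_underlying by (simp add: op_mult[OF _ _ x(1)] op_in_carrier[OF _ x(1)] smooth)
  next
    fix a b c assume "a \<in> carrier K" "b \<in> carrier K" "c \<in> carrier K"
    then obtain x where x: "x \<in> {1..3} \<rightarrow> carrier C"
      "a = cinf_op C 3 (\<lambda>y. y 1) x" "b = cinf_op C 3 (\<lambda>y. y 2) x" "c = cinf_op C 3 (\<lambda>y. y 3) x"
      using coordinates by blast
    show "a \<otimes>\<^bsub>K\<^esub> b \<otimes>\<^bsub>K\<^esub> c = a \<otimes>\<^bsub>K\<^esub> (b \<otimes>\<^bsub>K\<^esub> c)"
      unfolding x(2-) by (simp add: op_mult[OF _ _ x(1)] smooth mult.assoc)
  next
    fix a assume "a \<in> carrier K"
    then obtain x where x: "x \<in> {1..3} \<rightarrow> carrier C" "a = cinf_op C 3 (\<lambda>y. y 1) x"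
      using coordinates by blast
    show "\<one>\<^bsub>K\<^esub> \<otimes>\<^bsub>K\<^esub> a = a"
      unfolding x(2-) one by (simp add: op_mult[OF _ _ x(1)] smooth op_const[OF x(1)])
  qed (simp add: one const_closed)
  show ?thesis
  proof (rule cringI[OF ab mon])
    fix a b c assume "a \<in> carrier K" "b \<in> carrier K" "c \<in> carrier K"
    then obtain x where x: "x \<in> {1..3} \<rightarrow> carrier C"
      "a = cinf_op C 3 (\<lambda>y. y 1) x" "b = cinf_op C 3 (\<lambda>y. y 2) x" "c = cinf_op C 3 (\<lambda>y. y 3) x"
      using coordinates by blast
    show "(a \<oplus>\<^bsub>K\<^esub> b) \<otimes>\<^bsub>K\<^esub> c = a \<otimes>\<^bsub>K\<^esub> c \<oplus>\<^bsub>K\<^esub> b \<otimes>\<^bsub>K\<^esub> c"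
      unfolding x(2-) by (simp add: op_add[OF _ _ x(1)] op_mult[OF _ _ x(1)] smooth distrib_right)
  qed
qed

end


section \<open>Convolution and contraction of functions on words\<close>

context cring
begin

text \<open>
  The product of the tensor algebra, taken as an operation on all coefficient functions. Its laws can
  then be proved by recursion on the word at which both sides are evaluated.
\<close>

definition conv :: "(nat list \<Rightarrow> 'a) \<Rightarrow> (nat list \<Rightarrow> 'a) \<Rightarrow> nat list \<Rightarrow> 'a" where
  "conv f g w = (\<Oplus>l\<in>{..length w}. f (take l w) \<otimes> g (drop l w))"

text \<open>
  The coefficient at \<open>w\<close> of the contraction of \<open>f\<close> with the dual of the \<open>i\<close>-th basis vector, that is,
  the sum of $(-1)^{|u|} f(u\,i\,v)$ over all splittings $w = uv$. The recursion separates the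
  splitting with empty \<open>u\<close> from the others.
\<close>

fun contract :: "nat \<Rightarrow> (nat list \<Rightarrow> 'a) \<Rightarrow> nat list \<Rightarrow> 'a" where
  "contract i f [] = f [i]"
| "contract i f (a # w) = f (i # a # w) \<ominus> contract i (\<lambda>u. f (a # u)) w"

text \<open>
  The grade involution. It supplies the sign of the graded Leibniz rule also for elements that are not
  homogeneous.
\<close>

definition invol :: "(nat list \<Rightarrow> 'a) \<Rightarrow> nat list \<Rightarrow> 'a" where
  "invol f w = (if even (length w) then f w else \<ominus> f w)"

lemma conv_closed [simp]:
  "\<lbrakk>\<And>w. f w \<in> carrier R; \<And>w. g w \<in> carrier R\<rbrakk> \<Longrightarrow> conv f g w \<in> carrier R"
  by (auto simp: conv_def intro!: finsum_closed)

lemma contract_closed [simp]: "(\<And>w. f w \<in> carrier R) \<Longrightarrow> contract i f w \<in> carrier R"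
  by (induction w arbitrary: f) auto

lemma invol_closed [simp]: "(\<And>w. f w \<in> carrier R) \<Longrightarrow> invol f w \<in> carrier R"
  by (auto simp: invol_def)

lemma conv_Nil: "\<lbrakk>\<And>w. f w \<in> carrier R; \<And>w. g w \<in> carrier R\<rbrakk> \<Longrightarrow> conv f g [] = f [] \<otimes> g []"
  by (simp add: conv_def)

text \<open>
  The recursion behind the algebraic laws below: the splitting with empty left part is separated,
  and in the others the first letter \<open>a\<close> goes to the left factor.
\<close>

lemma conv_Cons:
  assumes "\<And>w. f w \<in> carrier R" "\<And>w. g w \<in> carrier R"
  shows "conv f g (a # w) = f [] \<otimes> g (a # w) \<oplus> conv (\<lambda>u. f (a # u)) g w"
proof -
  have "conv f g (a # w) =
      (\<Oplus>l\<in>{..length w}. f (take (Suc l) (a # w)) \<otimes> g (drop (Suc l) (a # w))) \<oplus> f [] \<otimes> g (a # w)"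
    using assms unfolding conv_def list.size(4) add_Suc_right add_0_right
    by (subst finsum_Suc2) auto
  also have "\<dots> = conv (\<lambda>u. f (a # u)) g w \<oplus> f [] \<otimes> g (a # w)"
    by (simp add: conv_def)
  finally show ?thesis
    using assms by (simp add: a_comm)
qed

lemma conv_add_left:
  assumes "\<And>w. f w \<in> carrier R" "\<And>w. g w \<in> carrier R" "\<And>w. h w \<in> carrier R"
  shows "conv (\<lambda>u. f u \<oplus> g u) h w = conv f h w \<oplus> conv g h w"
  using assms unfolding conv_def
  by (subst finsum_addf[symmetric]) (auto simp: l_distr)

lemma conv_add_right:
  assumes "\<And>w. f w \<in> carrier R" "\<And>w. g w \<in> carrier R" "\<And>w. h w \<in> carrier R"
  shows "conv h (\<lambda>u. f u \<oplus> g u) w = conv h f w \<oplus> conv h g w"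
  using assms unfolding conv_def
  by (subst finsum_addf[symmetric]) (auto simp: r_distr)

lemma conv_scale_left:
  assumes "\<And>w. f w \<in> carrier R" "\<And>w. g w \<in> carrier R" "c \<in> carrier R"
  shows "conv (\<lambda>u. c \<otimes> f u) g w = c \<otimes> conv f g w"
  using assms by (induction w arbitrary: f) (auto simp: conv_Nil conv_Cons r_distr m_assoc)

lemma conv_uminus_left:
  assumes "\<And>w. f w \<in> carrier R" "\<And>w. g w \<in> carrier R"
  shows "conv (\<lambda>u. \<ominus> f u) g w = \<ominus> conv f g w"
  using assms by (induction w arbitrary: f) (auto simp: conv_Nil conv_Cons minus_add l_minus)

text \<open>
  Induction on the word, simultaneously for all \<open>f\<close> and \<open>g\<close>, avoids reindexing a double sum: stripping the
  first letter of \<open>conv f g\<close> gives again a convolution plus a scalar multiple of a shift of \<open>g\<close>.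
\<close>

lemma conv_assoc:
  assumes "\<And>w. f w \<in> carrier R" "\<And>w. g w \<in> carrier R" "\<And>w. h w \<in> carrier R"
  shows "conv (conv f g) h w = conv f (conv g h) w"
  using assms
proof (induction w arbitrary: f g)
  case Nil
  then show ?case by (simp add: conv_Nil m_assoc)
next
  case (Cons a w)
  note [simp] = Cons.prems
  have "conv (conv f g) h (a # w) = f [] \<otimes> g [] \<otimes> h (a # w)
      \<oplus> conv (\<lambda>u. f [] \<otimes> g (a # u) \<oplus> conv (\<lambda>u. f (a # u)) g u) h w"
    by (simp add: conv_Cons conv_Nil)
  also have "\<dots> = f [] \<otimes> g [] \<otimes> h (a # w) \<oplus> (f [] \<otimes> conv (\<lambda>u. g (a # u)) h w
      \<oplus> conv (\<lambda>u. f (a # u)) (conv g h) w)"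
    by (simp add: conv_add_left conv_scale_left Cons.IH)
  also have "\<dots> = conv f (conv g h) (a # w)"
    by (simp add: conv_Cons r_distr m_assoc a_assoc)
  finally show ?case .
qed

lemma conv_zero_left [simp]: "(\<And>w. g w \<in> carrier R) \<Longrightarrow> conv (\<lambda>_. \<zero>) g w = \<zero>"
  by (simp add: conv_def finsum_zero)

lemma monom_closed [simp]: "c \<in> carrier R \<Longrightarrow> tensor_monom R c v w \<in> carrier R"
  by (simp add: tensor_monom_def)

lemma monom_Cons_shift:
  "(\<lambda>u. tensor_monom R c (b # v) (a # u)) = (if a = b then tensor_monom R c v else (\<lambda>_. \<zero>))"
  "(\<lambda>u. tensor_monom R c [] (a # u)) = (\<lambda>_. \<zero>)"
  by (auto simp: tensor_monom_def)

lemma conv_scalar_left: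
  assumes "c \<in> carrier R" "\<And>w. f w \<in> carrier R"
  shows "conv (tensor_monom R c []) f w = c \<otimes> f w"
  using assms by (cases w) (auto simp: conv_Nil conv_Cons monom_Cons_shift, auto simp: tensor_monom_def)

lemma conv_scalar_right:
  assumes "c \<in> carrier R" "\<And>w. f w \<in> carrier R"
  shows "conv f (tensor_monom R c []) w = c \<otimes> f w"
  using assms
proof (induction w arbitrary: f)
  case (Cons a w)
  then show ?case by (auto simp: conv_Cons) (auto simp: tensor_monom_def)
qed (auto simp: conv_Nil tensor_monom_def m_comm)

lemma conv_monom:
  assumes "c \<in> carrier R" "d \<in> carrier R"
  shows "conv (tensor_monom R c u) (tensor_monom R d v) w = tensor_monom R (c \<otimes> d) (u @ v) w"
  using assms
proof (induction u arbitrary: w)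
  case Nil
  then show ?case by (simp add: conv_scalar_left) (simp add: tensor_monom_def)
next
  case (Cons b u)
  show ?case
  proof (cases w)
    case Nil
    with Cons show ?thesis by (simp add: conv_Nil) (simp add: tensor_monom_def)
  next
    case (Cons a w')
    have "tensor_monom R c (b # u) [] = \<zero>" by (simp add: tensor_monom_def)
    then show ?thesis
      using \<open>c \<in> carrier R\<close> \<open>d \<in> carrier R\<close> Cons.IH[of w'] unfolding Cons
      by (auto simp: conv_Cons monom_Cons_shift) (auto simp: tensor_monom_def)
  qed
qed

lemma conv_support: 
  assumes "\<And>w. f w \<in> carrier R" "\<And>w. g w \<in> carrier R" "conv f g w \<noteq> \<zero>"
  shows "\<exists>u v. w = u @ v \<and> f u \<noteq> \<zero> \<and> g v \<noteq> \<zero>"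
proof (rule ccontr)
  assume none: "\<not> ?thesis"
  have "f (take l w) \<otimes> g (drop l w) = \<zero>" for l
    using none[simplified, rule_format, of "take l w" "drop l w"] assms by auto
  then show False using assms(3) by (simp add: conv_def finsum_zero)
qed

lemma contract_add:
  assumes "\<And>w. f w \<in> carrier R" "\<And>w. g w \<in> carrier R"
  shows "contract i (\<lambda>u. f u \<oplus> g u) w = contract i f w \<oplus> contract i g w"
  using assms
proof (induction w arbitrary: f g)
  case (Cons a w)
  note [simp] = Cons.prems
  show ?case by (simp add: Cons.IH minus_eq minus_add a_ac)
qed simp

lemma contract_scale:
  assumes "\<And>w. f w \<in> carrier R" "c \<in> carrier R"
  shows "contract i (\<lambda>u. c \<otimes> f u) w = c \<otimes> contract i f w"
  using assms
proof (induction w arbitrary: f)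
  case (Cons a w)
  note [simp] = Cons.prems
  show ?case by (simp add: Cons.IH minus_eq r_distr r_minus)
qed simp

lemma contract_zero [simp]: "contract i (\<lambda>_. \<zero>) w = \<zero>"
  by (induction w) (auto simp: minus_eq)

text \<open>
  The graded Leibniz rule. In the recursion the sign of \<open>contract\<close> in front of the shifted word and the sign
  that \<open>invol\<close> acquires under a shift agree.
\<close>

lemma contract_conv:
  assumes "\<And>w. f w \<in> carrier R" "\<And>w. g w \<in> carrier R"
  shows "contract i (conv f g) w = conv (contract i f) g w \<oplus> conv (invol f) (contract i g) w"
  using assms
proof (induction w arbitrary: f)
  case Nil
  then show ?case by (simp add: conv_Nil conv_Cons) (simp add: invol_def a_comm)
next
  case (Cons a w)
  note [simp] = Cons.prems
  let ?f = "\<lambda>u. f (a # u)" and ?g = "\<lambda>u. g (a # u)"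
  define P where "P = conv (\<lambda>u. f (i # a # u)) g w"
  define Q where "Q = conv (contract i ?f) g w"
  define S where "S = conv (invol ?f) (contract i g) w"
  define x where "x = f [] \<otimes> g (i # a # w)"
  define y where "y = f [i] \<otimes> g (a # w)"
  define z where "z = f [] \<otimes> contract i ?g w"
  have cl: "P \<in> carrier R" "Q \<in> carrier R" "S \<in> carrier R" "x \<in> carrier R" "y \<in> carrier R" "z \<in> carrier R"
    by (auto simp: P_def Q_def S_def x_def y_def z_def)
  have sh: "(\<lambda>u. invol f (a # u)) = (\<lambda>u. \<ominus> invol ?f u)"
    by (auto simp: invol_def)
  have "contract i (conv f g) (a # w) =
      x \<oplus> (y \<oplus> P) \<ominus> contract i (\<lambda>u. f [] \<otimes> g (a # u) \<oplus> conv ?f g u) w"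
    by (simp add: conv_Cons x_def y_def P_def)
  also have "\<dots> = x \<oplus> (y \<oplus> P) \<ominus> (z \<oplus> (Q \<oplus> S))"
    by (simp add: contract_add contract_scale Cons.IH z_def Q_def S_def)
  also have "\<dots> = (y \<oplus> (P \<oplus> \<ominus> Q)) \<oplus> ((x \<oplus> \<ominus> z) \<oplus> \<ominus> S)"
    using cl by (simp add: minus_eq minus_add a_ac)
  also have "\<dots> = conv (contract i f) g (a # w) \<oplus> conv (invol f) (contract i g) (a # w)"
    by (simp add: conv_Cons sh conv_uminus_left minus_eq conv_add_left r_distr r_minus
        x_def y_def z_def P_def Q_def S_def invol_def[of f "[]"])
  finally show ?case .
qed

lemma invol_conv:
  assumes "\<And>w. f w \<in> carrier R" "\<And>w. g w \<in> carrier R"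
  shows "invol (conv f g) w = conv (invol f) (invol g) w"
  using assms
proof (induction w arbitrary: f)
  case Nil
  then show ?case by (simp add: conv_Nil invol_def)
next
  case (Cons a w)
  note [simp] = Cons.prems
  have sh: "(\<lambda>u. invol f (a # u)) = (\<lambda>u. \<ominus> invol (\<lambda>u. f (a # u)) u)"
    by (auto simp: invol_def)
  show ?case
    using Cons.IH[of "\<lambda>u. f (a # u)", symmetric]
    by (auto simp: conv_Cons sh conv_uminus_left invol_def[of "conv _ _"] invol_def[of f "[]"]
        invol_def[of g "_ # _"] minus_add r_minus split: if_splits)
qed

lemma contract_support:
  assumes "\<And>w. f w \<in> carrier R" "contract i f w \<noteq> \<zero>"
  shows "\<exists>u v. w = u @ v \<and> f (u @ i # v) \<noteq> \<zero>"
  using assms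
proof (induction w arbitrary: f)
  case (Cons a w)
  show ?case
  proof (cases "f (i # a # w) = \<zero>")
    case True
    then have "contract i (\<lambda>u. f (a # u)) w \<noteq> \<zero>"
      using Cons.prems by (auto simp: minus_eq)
    then obtain u v where "w = u @ v" "f (a # u @ i # v) \<noteq> \<zero>"
      using Cons.IH[of "\<lambda>u. f (a # u)"] Cons.prems by auto
    then show ?thesis by (intro exI[of _ "a # u"] exI[of _ v]) auto
  next
    case False
    then show ?thesis by (intro exI[of _ "[]"] exI[of _ "a # w"]) auto
  qed
qed auto

end


section \<open>The tensor algebra and its exterior quotient\<close>

text \<open>
  The exterior algebra \<open>E\<close> of the free module with basis \<open>{1..q}\<close> over a commutative ring, as the quotient
  of the tensor algebra \<open>T\<close> by the ideal \<open>J\<close>; \<open>pr\<close> is the projection.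
\<close>

locale free_exterior = cring R for R (structure) +
  fixes q :: nat
begin

abbreviation T where "T \<equiv> tensor_algebra R q"
abbreviation J where "J \<equiv> exterior_ideal R q"
abbreviation E where "E \<equiv> exterior_algebra R q"
abbreviation mon where "mon \<equiv> tensor_monom R"
abbreviation pr where "pr x \<equiv> J +>\<^bsub>T\<^esub> x"

lemma T_carrier_iff:
  "x \<in> carrier T \<longleftrightarrow> (\<forall>w. x w \<in> carrier R) \<and> finite {w. x w \<noteq> \<zero>} \<and> (\<forall>w. x w \<noteq> \<zero> \<longrightarrow> w \<in> lists {1..q})"
  unfolding tensor_algebra_def partial_object.simps by blast

lemma T_simps:
  "x \<otimes>\<^bsub>T\<^esub> y = conv x y" "\<one>\<^bsub>T\<^esub> = mon \<one> []" "\<zero>\<^bsub>T\<^esub> = (\<lambda>_. \<zero>)"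
  "x \<oplus>\<^bsub>T\<^esub> y = (\<lambda>w. x w \<oplus> y w)"
  by (auto simp: tensor_algebra_def tensor_monom_def conv_def fun_eq_iff)

lemma in_T_I:
  assumes "\<And>w. x w \<in> carrier R" "finite S" "\<And>w. x w \<noteq> \<zero> \<Longrightarrow> w \<in> S"
    "\<And>w. x w \<noteq> \<zero> \<Longrightarrow> w \<in> lists {1..q}"
  shows "x \<in> carrier T"
proof -
  have "finite {w. x w \<noteq> \<zero>}"
    by (rule finite_subset[OF _ assms(2)]) (use assms(3) in blast)
  with assms(1,4) show ?thesis
    by (intro T_carrier_iff[THEN iffD2] conjI allI impI)
qed

lemma T_coeff [simp]: "x \<in> carrier T \<Longrightarrow> x w \<in> carrier R"
  by (simp only: T_carrier_iff)

lemma T_support: "x \<in> carrier T \<Longrightarrow> x w \<noteq> \<zero> \<Longrightarrow> w \<in> lists {1..q}"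
  by (drule T_carrier_iff[THEN iffD1]) (elim conjE allE impE)

lemma T_finite_support: "x \<in> carrier T \<Longrightarrow> finite {w. x w \<noteq> \<zero>}"
  by (simp only: T_carrier_iff)

lemma in_T_if_support_subset:
  assumes "y \<in> carrier T" "\<And>w. x w \<in> carrier R" "\<And>w. x w \<noteq> \<zero> \<Longrightarrow> y w \<noteq> \<zero>"
  shows "x \<in> carrier T"
  by (rule in_T_I[OF assms(2) T_finite_support[OF assms(1)]])
    (use assms(3) T_support[OF assms(1)] in blast)+

lemma zero_in_T: "(\<lambda>_. \<zero>) \<in> carrier T"
  by (rule in_T_I[where S = "{}"]) auto

lemma mon_in_T: "c \<in> carrier R \<Longrightarrow> w \<in> lists {1..q} \<Longrightarrow> mon c w \<in> carrier T"
  by (rule in_T_I[where S = "{w}"]) (auto simp: tensor_monom_def split: if_splits)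

lemma conv_in_T:
  assumes x: "x \<in> carrier T" and y: "y \<in> carrier T"
  shows "conv x y \<in> carrier T"
proof (rule in_T_I)
  have supp: "\<exists>u v. w = u @ v \<and> x u \<noteq> \<zero> \<and> y v \<noteq> \<zero>" if "conv x y w \<noteq> \<zero>" for w
    using conv_support[of x y w] x y that by simp
  show "finite ((\<lambda>(u, v). u @ v) ` ({w. x w \<noteq> \<zero>} \<times> {w. y w \<noteq> \<zero>}))"
    by (intro finite_imageI finite_cartesian_product T_finite_support x y)
  fix w
  show "conv x y w \<in> carrier R" using x y by simp
  assume "conv x y w \<noteq> \<zero>"
  then obtain u v where uv: "w = u @ v" "x u \<noteq> \<zero>" "y v \<noteq> \<zero>"
    using supp by blast
  show "w \<in> (\<lambda>(u, v). u @ v) ` ({w. x w \<noteq> \<zero>} \<times> {w. y w \<noteq> \<zero>})"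
    using uv by force
  show "w \<in> lists {1..q}"
    using T_support[OF x uv(2)] T_support[OF y uv(3)] uv(1) by simp
qed

lemma scale_in_T: "c \<in> carrier R \<Longrightarrow> x \<in> carrier T \<Longrightarrow> (\<lambda>w. c \<otimes> x w) \<in> carrier T"
  by (rule in_T_if_support_subset[of x]) auto

lemma contract_in_T:
  assumes x: "x \<in> carrier T"
  shows "contract i x \<in> carrier T"
proof (rule in_T_I)
  let ?S = "\<Union>z\<in>{w. x w \<noteq> \<zero>}. (\<lambda>l. take l z @ drop (Suc l) z) ` {..length z}"
  show "finite ?S"
    by (intro finite_UN_I T_finite_support[OF x]) simp
  fix w
  show "contract i x w \<in> carrier R" using x by simp
  assume "contract i x w \<noteq> \<zero>"
  then obtain u v where uv: "w = u @ v" "x (u @ i # v) \<noteq> \<zero>"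
    using contract_support[of x i w] x by auto
  show "w \<in> ?S"
    using uv by (intro UN_I[of "u @ i # v"] image_eqI[of _ _ "length u"]) auto
  show "w \<in> lists {1..q}"
    using T_support[OF x uv(2)] uv(1) by simp
qed

lemma invol_in_T: "x \<in> carrier T \<Longrightarrow> invol x \<in> carrier T"
  by (rule in_T_if_support_subset[of x]) (auto simp: invol_def split: if_splits)

lemma ring_T: "ring T"
proof (rule ringI)
  show "abelian_group T"
  proof (rule abelian_groupI)
    fix x y assume x: "x \<in> carrier T" and y: "y \<in> carrier T"
    show "x \<oplus>\<^bsub>T\<^esub> y \<in> carrier T"
      unfolding T_simps
    proof (rule in_T_I)
      show "finite ({w. x w \<noteq> \<zero>} \<union> {w. y w \<noteq> \<zero>})"
        by (simp add: T_finite_support x y)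
      fix w
      show "x w \<oplus> y w \<in> carrier R" using x y by simp
      assume nz: "x w \<oplus> y w \<noteq> \<zero>"
      then show "w \<in> {w. x w \<noteq> \<zero>} \<union> {w. y w \<noteq> \<zero>}" by auto
      then show "w \<in> lists {1..q}"
        using T_support[OF x] T_support[OF y] by blast
    qed
    show "x \<oplus>\<^bsub>T\<^esub> y = y \<oplus>\<^bsub>T\<^esub> x"
      using x y by (simp add: T_simps a_comm)
  next
    fix x assume x: "x \<in> carrier T"
    have "(\<lambda>w. \<ominus> \<one> \<otimes> x w) \<in> carrier T"
      by (intro scale_in_T x) simp
    moreover have "(\<lambda>w. \<ominus> \<one> \<otimes> x w) \<oplus>\<^bsub>T\<^esub> x = \<zero>\<^bsub>T\<^esub>"
      using x by (simp add: T_simps l_minus l_neg)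
    ultimately show "\<exists>y\<in>carrier T. y \<oplus>\<^bsub>T\<^esub> x = \<zero>\<^bsub>T\<^esub>" by blast
  qed (auto simp: T_simps a_assoc zero_in_T)
next
  show "monoid T"
    by (rule monoidI)
      (auto simp: T_simps conv_in_T mon_in_T conv_assoc conv_scalar_left conv_scalar_right fun_eq_iff)
qed (auto simp: T_simps fun_eq_iff conv_add_left conv_add_right)

sublocale T: ring T
  by (rule ring_T)

lemma T_uminus: "x \<in> carrier T \<Longrightarrow> \<ominus>\<^bsub>T\<^esub> x = (\<lambda>w. \<ominus> x w)"
proof -
  assume x: "x \<in> carrier T"
  have "(\<lambda>w. \<ominus> \<one> \<otimes> x w) \<in> carrier T"
    by (intro scale_in_T x) simp
  then have "(\<lambda>w. \<ominus> x w) \<in> carrier T"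
    using x by (simp add: l_minus)
  moreover have "(\<lambda>w. \<ominus> x w) \<oplus>\<^bsub>T\<^esub> x = \<zero>\<^bsub>T\<^esub>"
    using x by (simp add: T_simps l_neg)
  ultimately show ?thesis using x T.minus_equality by metis
qed

text \<open>
  The tensors supported in \<open>S\<close> are generated additively by their monomials.
\<close>

lemma tensor_induct [consumes 2, case_names zero mon add]:
  assumes x: "x \<in> carrier T" and S: "{w. x w \<noteq> \<zero>} \<subseteq> S"
    and zero: "P \<zero>\<^bsub>T\<^esub>"
    and mon: "\<And>c w. \<lbrakk>c \<in> carrier R; w \<in> lists {1..q}; w \<in> S\<rbrakk> \<Longrightarrow> P (mon c w)"
    and add: "\<And>x y. \<lbrakk>x \<in> carrier T; y \<in> carrier T; P x; P y\<rbrakk> \<Longrightarrow> P (x \<oplus>\<^bsub>T\<^esub> y)"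
  shows "P x"
proof -
  have "finite A \<Longrightarrow> x \<in> carrier T \<Longrightarrow> {w. x w \<noteq> \<zero>} \<subseteq> A \<inter> S \<Longrightarrow> P x" for A x
  proof (induction A arbitrary: x rule: finite_induct)
    case empty
    then have "x = \<zero>\<^bsub>T\<^esub>" by (auto simp: T_simps)
    then show ?case using zero by simp
  next
    case (insert v A)
    define y where "y = x(v := \<zero>)"
    have y: "y \<in> carrier T"
      by (rule in_T_if_support_subset[OF insert.prems(1)])
        (use insert.prems(1) in \<open>auto simp: y_def split: if_splits\<close>)
    have Py: "P y"
      using insert.prems by (intro insert.IH y) (auto simp: y_def)
    show ?case
    proof (cases "x v = \<zero>")
      case True
      then have "y = x" by (auto simp: y_def)
      with Py show ?thesis by simp
    next
      case False
      have v: "v \<in> lists {1..q}" "v \<in> S" "x v \<in> carrier R"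
        using False insert.prems T_support[of x v] by auto
      have "x = mon (x v) v \<oplus>\<^bsub>T\<^esub> y"
        using insert.prems(1) by (auto simp: T_simps y_def tensor_monom_def fun_eq_iff)
      then show ?thesis
        using add[OF mon_in_T[OF v(3,1)] y mon[OF v(3,1,2)] Py] by simp
    qed
  qed
  from this[of "{w. x w \<noteq> \<zero>}" x] show ?thesis
    using T_finite_support[OF x] x S by blast
qed

definition squares where
  "squares = {v \<otimes>\<^bsub>T\<^esub> v | v. v \<in> carrier T \<and> (\<forall>w. v w \<noteq> \<zero> \<longrightarrow> length w = 1)}"

lemma squares_carrier: "squares \<subseteq> carrier T"
  by (auto simp: squares_def)

lemma J_def': "J = Idl\<^bsub>T\<^esub> squares"
  by (simp add: exterior_ideal_def squares_def)

sublocale J: ideal J T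
  unfolding J_def' by (rule T.genideal_ideal[OF squares_carrier])

sublocale E: ring E
  unfolding exterior_algebra_def by (rule J.quotient_is_ring)

lemma pr_hom: "(\<lambda>x. pr x) \<in> ring_hom T E"
  unfolding exterior_algebra_def by (rule J.rcos_ring_hom)

lemma pr_closed [simp]: "x \<in> carrier T \<Longrightarrow> pr x \<in> carrier E"
  using pr_hom by (rule ring_hom_closed)

lemma pr_mult: "x \<in> carrier T \<Longrightarrow> y \<in> carrier T \<Longrightarrow> pr (x \<otimes>\<^bsub>T\<^esub> y) = pr x \<otimes>\<^bsub>E\<^esub> pr y"
  using pr_hom by (rule ring_hom_mult)

lemma pr_add: "x \<in> carrier T \<Longrightarrow> y \<in> carrier T \<Longrightarrow> pr (x \<oplus>\<^bsub>T\<^esub> y) = pr x \<oplus>\<^bsub>E\<^esub> pr y"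
  using pr_hom by (rule ring_hom_add)

lemma pr_one: "pr \<one>\<^bsub>T\<^esub> = \<one>\<^bsub>E\<^esub>"
  using pr_hom by (rule ring_hom_one)

lemma pr_zero: "pr \<zero>\<^bsub>T\<^esub> = \<zero>\<^bsub>E\<^esub>"
  using pr_hom T.ring_axioms E.ring_axioms by (rule ring_hom_zero)

lemma pr_uminus: "x \<in> carrier T \<Longrightarrow> pr (\<ominus>\<^bsub>T\<^esub> x) = \<ominus>\<^bsub>E\<^esub> pr x"
  by (metis E.minus_equality T.a_inv_closed T.l_neg pr_add pr_closed pr_zero)

lemma pr_surj: "carrier E = (\<lambda>x. pr x) ` carrier T"
  by (auto simp: exterior_algebra_def FactRing_def A_RCOSETS_def')

lemma pr_eq_iff: "x \<in> carrier T \<Longrightarrow> y \<in> carrier T \<Longrightarrow> pr x = pr y \<longleftrightarrow> x \<ominus>\<^bsub>T\<^esub> y \<in> J"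
  using T.quotient_eq_iff_same_a_r_cos[OF J.ideal_axioms] by metis

lemma contract_T_add:
  "x \<in> carrier T \<Longrightarrow> y \<in> carrier T \<Longrightarrow> contract i (x \<oplus>\<^bsub>T\<^esub> y) = contract i x \<oplus>\<^bsub>T\<^esub> contract i y"
  by (simp add: T_simps fun_eq_iff contract_add)

text \<open>
  The rules on functions, restated in the ring \<open>T\<close>, where ideals are available.
\<close>

lemma contract_T_mult:
  "x \<in> carrier T \<Longrightarrow> y \<in> carrier T \<Longrightarrow> contract i (x \<otimes>\<^bsub>T\<^esub> y) =
     contract i x \<otimes>\<^bsub>T\<^esub> y \<oplus>\<^bsub>T\<^esub> invol x \<otimes>\<^bsub>T\<^esub> contract i y"
  by (simp add: T_simps fun_eq_iff contract_conv)

lemma invol_T_mult: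
  "x \<in> carrier T \<Longrightarrow> y \<in> carrier T \<Longrightarrow> invol (x \<otimes>\<^bsub>T\<^esub> y) = invol x \<otimes>\<^bsub>T\<^esub> invol y"
  by (simp add: T_simps fun_eq_iff invol_conv)

lemma invol_T_add:
  "x \<in> carrier T \<Longrightarrow> y \<in> carrier T \<Longrightarrow> invol (x \<oplus>\<^bsub>T\<^esub> y) = invol x \<oplus>\<^bsub>T\<^esub> invol y"
  by (auto simp: T_simps fun_eq_iff invol_def minus_add)

text \<open>
  On tensors of pure parity the involution is a sign; this turns the twisted Leibniz rule into the graded
  one.
\<close>

lemma invol_parity:
  assumes "x \<in> carrier T" "\<And>w. x w \<noteq> \<zero> \<Longrightarrow> length w mod 2 = p mod 2"
  shows "invol x = (if even p then x else \<ominus>\<^bsub>T\<^esub> x)"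
proof -
  have "even (length w) \<longleftrightarrow> even p" if "x w \<noteq> \<zero>" for w
    using assms(2)[OF that] by presburger
  then show ?thesis
    using assms(1) by (auto simp: T_uminus invol_def fun_eq_iff) (metis minus_zero)+
qed

text \<open>
  The elements of \<open>J\<close> whose contraction and involution stay in \<open>J\<close> form an ideal by the Leibniz rule, and
  this ideal contains the generators of \<open>J\<close>. The involution has to be carried along because
  it appears in the contraction of a product.
\<close>

lemma contract_ideal:
  assumes "x \<in> J"
  shows "contract i x \<in> J"
proof -
  let ?I = "{x \<in> J. contract i x \<in> J \<and> invol x \<in> J}"
  have "ideal ?I T"
  proof (rule idealI[OF T.ring_axioms])
    have left: "y \<otimes>\<^bsub>T\<^esub> x \<in> ?I" if x: "x \<in> ?I" and y: "y \<in> carrier T" for x y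
    proof -
      have xT: "x \<in> carrier T" using x J.Icarr by blast
      show ?thesis
        using x y xT
        by (simp add: contract_T_mult invol_T_mult J.I_l_closed contract_in_T invol_in_T J.a_closed)
    qed
    show "y \<otimes>\<^bsub>T\<^esub> x \<in> ?I" if "x \<in> ?I" "y \<in> carrier T" for x y using left that .
    show "x \<otimes>\<^bsub>T\<^esub> y \<in> ?I" if x: "x \<in> ?I" and y: "y \<in> carrier T" for x y
    proof -
      have xT: "x \<in> carrier T" using x J.Icarr by blast
      show ?thesis
        using x y xT
        by (simp add: contract_T_mult invol_T_mult J.I_r_closed contract_in_T invol_in_T J.a_closed)
    qed
    show "subgroup ?I (add_monoid T)"
    proof (rule T.add.subgroupI)
      show "?I \<subseteq> carrier T" using J.Icarr by blast
      have "contract i \<zero>\<^bsub>T\<^esub> = \<zero>\<^bsub>T\<^esub>" "invol \<zero>\<^bsub>T\<^esub> = \<zero>\<^bsub>T\<^esub>"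
        by (auto simp: T_simps fun_eq_iff invol_def)
      then have "\<zero>\<^bsub>T\<^esub> \<in> ?I" by simp
      then show "?I \<noteq> {}" by blast
    next
      fix x assume x: "x \<in> ?I"
      then have "x \<in> carrier T" using J.Icarr by blast
      \<comment> \<open>Closure under negation comes for free from closure under left multiplication.\<close>
      then have "\<ominus>\<^bsub>T\<^esub> x = (\<ominus>\<^bsub>T\<^esub> \<one>\<^bsub>T\<^esub>) \<otimes>\<^bsub>T\<^esub> x" by (simp add: T.l_minus)
      then show "\<ominus>\<^bsub>T\<^esub> x \<in> ?I" using left[OF x, of "\<ominus>\<^bsub>T\<^esub> \<one>\<^bsub>T\<^esub>"] by simp
    next
      fix x y assume "x \<in> ?I" "y \<in> ?I"
      moreover from this have "x \<in> carrier T" "y \<in> carrier T" using J.Icarr by blast+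
      ultimately show "x \<oplus>\<^bsub>T\<^esub> y \<in> ?I"
        by (simp add: contract_T_add invol_T_add J.a_closed)
    qed
  qed
  moreover have "squares \<subseteq> ?I"
  proof
    fix s assume "s \<in> squares"
    then obtain v where v: "s = v \<otimes>\<^bsub>T\<^esub> v" "v \<in> carrier T" "\<And>w. v w \<noteq> \<zero> \<Longrightarrow> length w = 1"
      by (auto simp: squares_def)
    have sJ: "s \<in> J"
      using \<open>s \<in> squares\<close> T.genideal_self[OF squares_carrier] by (auto simp: J_def')
    have inv: "invol v = \<ominus>\<^bsub>T\<^esub> v"
      using invol_parity[of v 1] v by auto
    then have "invol s = s"
      using v(1,2) by (simp add: invol_T_mult T.l_minus T.r_minus)
    have "contract i v w = \<zero>" if "w \<noteq> []" for w
    proof (rule ccontr)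
      assume "contract i v w \<noteq> \<zero>"
      then obtain a b where "w = a @ b" "v (a @ i # b) \<noteq> \<zero>"
        using contract_support[of v i w] v(2) by auto
      then show False using v(3) that by fastforce
    qed
    \<comment> \<open>A vector is contracted to its \<open>i\<close>-th coordinate.\<close>
    then have c: "contract i v = mon (v [i]) []"
      by (auto simp: fun_eq_iff tensor_monom_def)
    have "contract i s = conv (mon (v [i]) []) v \<oplus>\<^bsub>T\<^esub> conv (\<ominus>\<^bsub>T\<^esub> v) (mon (v [i]) [])"
      using v(1,2) by (simp add: contract_T_mult inv c) (simp add: T_simps)
    also have "\<dots> = \<zero>\<^bsub>T\<^esub>"
      using v(2) by (auto simp: T_simps fun_eq_iff conv_scalar_left conv_scalar_right T_uminus r_minus r_neg)
    finally show "s \<in> ?I" using sJ \<open>invol s = s\<close> by simp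
  qed
  ultimately have "J \<subseteq> ?I" unfolding J_def' by (rule T.genideal_minimal)
  with assms show ?thesis by blast
qed

end


section \<open>Monomials, reordering, and the grading\<close>

context free_exterior
begin

abbreviation gen where "gen j \<equiv> pr (mon \<one> [j])"

lemma mon_mult: "c \<in> carrier R \<Longrightarrow> d \<in> carrier R \<Longrightarrow> mon c u \<otimes>\<^bsub>T\<^esub> mon d v = mon (c \<otimes> d) (u @ v)"
  by (simp add: T_simps conv_monom fun_eq_iff)

lemma pr_mon_mult:
  assumes "c \<in> carrier R" "d \<in> carrier R" "u \<in> lists {1..q}" "v \<in> lists {1..q}"
  shows "pr (mon c u) \<otimes>\<^bsub>E\<^esub> pr (mon d v) = pr (mon (c \<otimes> d) (u @ v))"
  using pr_mult[OF mon_in_T[OF assms(1,3)] mon_in_T[OF assms(2,4)]] assms by (simp add: mon_mult)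

lemma gen_mult_mon:
  assumes "c \<in> carrier R" "j \<in> {1..q}" "w \<in> lists {1..q}"
  shows "gen j \<otimes>\<^bsub>E\<^esub> pr (mon c w) = pr (mon c (j # w))"
  using pr_mon_mult[of \<one> c "[j]" w] assms by simp

lemma gen_closed: "j \<in> {1..q} \<Longrightarrow> gen j \<in> carrier E"
  by (intro pr_closed mon_in_T) auto

lemma pr_mon_closed: "c \<in> carrier R \<Longrightarrow> w \<in> lists {1..q} \<Longrightarrow> pr (mon c w) \<in> carrier E"
  by (intro pr_closed mon_in_T)

lemma ext_monom_eq: "w \<in> lists {1..q} \<Longrightarrow> ext_monom R q w = pr (mon \<one> w)"
proof (induction w)
  case Nil
  then show ?case by (simp add: ext_monom_def pr_one[symmetric] T_simps)
next
  case (Cons j w)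
  then have "ext_monom R q (j # w) = gen j \<otimes>\<^bsub>E\<^esub> pr (mon \<one> w)"
    by (simp add: ext_monom_def ext_gen_def)
  also have "\<dots> = pr (mon \<one> (j # w))"
    using Cons.prems by (intro gen_mult_mon) auto
  finally show ?case .
qed

lemma scalar_mult_monom:
  "c \<in> carrier R \<Longrightarrow> w \<in> lists {1..q} \<Longrightarrow> ext_scalar R q c \<otimes>\<^bsub>E\<^esub> ext_monom R q w = pr (mon c w)"
  using pr_mon_mult[of c \<one> "[]" w] by (simp add: ext_monom_eq ext_scalar_def)

lemma restrict_in_T:
  assumes "finite W" "W \<subseteq> lists {1..q}" "c \<in> W \<rightarrow> carrier R"
  shows "(\<lambda>w. if w \<in> W then c w else \<zero>) \<in> carrier T"
  by (rule in_T_I[where S = W]) (use assms in \<open>auto split: if_splits\<close>)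

text \<open>
  A linear combination of monomials in the exterior algebra lifts to the tensor that has the same
  coefficients.
\<close>

lemma finsum_monomials:
  assumes "finite W" "W \<subseteq> lists {1..q}" "c \<in> W \<rightarrow> carrier R"
  shows "(\<Oplus>\<^bsub>E\<^esub>w\<in>W. ext_scalar R q (c w) \<otimes>\<^bsub>E\<^esub> ext_monom R q w) = pr (\<lambda>w. if w \<in> W then c w else \<zero>)"
  using assms
proof (induction W rule: finite_induct)
  case empty
  then show ?case by (simp add: pr_zero[symmetric] T_simps)
next
  case (insert v W)
  let ?t = "\<lambda>w. ext_scalar R q (c w) \<otimes>\<^bsub>E\<^esub> ext_monom R q w"
  have v: "v \<in> lists {1..q}" "c v \<in> carrier R" and W: "W \<subseteq> lists {1..q}" "c \<in> W \<rightarrow> carrier R"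
    using insert.prems by auto
  have t: "?t w \<in> carrier E" if "w \<in> insert v W" for w
  proof -
    have "c w \<in> carrier R" "w \<in> lists {1..q}" using that insert.prems by blast+
    then show ?thesis by (simp only: scalar_mult_monom pr_mon_closed)
  qed
  have "finsum E ?t (insert v W) = ?t v \<oplus>\<^bsub>E\<^esub> finsum E ?t W"
    using insert.hyps t by (intro E.finsum_insert) auto
  also have "\<dots> = pr (mon (c v) v) \<oplus>\<^bsub>E\<^esub> pr (\<lambda>w. if w \<in> W then c w else \<zero>)"
    by (simp only: scalar_mult_monom v insert.IH W)
  also have "\<dots> = pr (mon (c v) v \<oplus>\<^bsub>T\<^esub> (\<lambda>w. if w \<in> W then c w else \<zero>))"
    by (rule pr_add[symmetric]) (intro mon_in_T restrict_in_T v W insert.hyps)+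
  also have "mon (c v) v \<oplus>\<^bsub>T\<^esub> (\<lambda>w. if w \<in> W then c w else \<zero>)
      = (\<lambda>w. if w \<in> insert v W then c w else \<zero>)"
    using insert.hyps v W by (auto simp: T_simps tensor_monom_def fun_eq_iff Pi_iff)
  finally show ?case .
qed

text \<open>
  Spans in the quotient are thereby handled as images of sets of tensors, on which sums and supports
  are computed coefficientwise.
\<close>

lemma ext_span_eq:
  assumes "finite W" "W \<subseteq> lists {1..q}"
  shows "ext_span R q W = (\<lambda>x. pr x) ` {x \<in> carrier T. \<forall>w. x w \<noteq> \<zero> \<longrightarrow> w \<in> W}"
proof (intro equalityI subsetI)
  fix a assume "a \<in> ext_span R q W"
  then obtain c where c: "c \<in> W \<rightarrow> carrier R"
    and a: "a = (\<Oplus>\<^bsub>E\<^esub>w\<in>W. ext_scalar R q (c w) \<otimes>\<^bsub>E\<^esub> ext_monom R q w)"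
    unfolding ext_span_def by blast
  show "a \<in> (\<lambda>x. pr x) ` {x \<in> carrier T. \<forall>w. x w \<noteq> \<zero> \<longrightarrow> w \<in> W}"
    unfolding a finsum_monomials[OF assms c]
    by (intro imageI CollectI conjI restrict_in_T assms c) auto
next
  fix a assume "a \<in> (\<lambda>x. pr x) ` {x \<in> carrier T. \<forall>w. x w \<noteq> \<zero> \<longrightarrow> w \<in> W}"
  then obtain x where x: "x \<in> carrier T" "\<And>w. x w \<noteq> \<zero> \<Longrightarrow> w \<in> W" and a: "a = pr x" by blast
  have "(if w \<in> W then x w else \<zero>) = x w" for w
    using x(2)[of w] by (cases "x w = \<zero>") auto
  then have "(\<lambda>w. if w \<in> W then x w else \<zero>) = x" by (rule ext)
  then have "a = (\<Oplus>\<^bsub>E\<^esub>w\<in>W. ext_scalar R q (x w) \<otimes>\<^bsub>E\<^esub> ext_monom R q w)"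
    using finsum_monomials[OF assms, of x] x(1) a by simp
  then show "a \<in> ext_span R q W"
    unfolding ext_span_def using x(1) by auto
qed

lemma finite_increasing_words: "finite (increasing_words q)"
proof (rule finite_subset)
  show "increasing_words q \<subseteq> {w. set w \<subseteq> {1..q} \<and> length w \<le> q}"
  proof
    fix w assume w: "w \<in> increasing_words q"
    then have "distinct w" "set w \<subseteq> {1..q}"
      by (auto simp: increasing_words_def strict_sorted_iff)
    then show "w \<in> {w. set w \<subseteq> {1..q} \<and> length w \<le> q}"
      using card_mono[of "{1..q}" "set w"] by (simp add: distinct_card)
  qed
qed (rule finite_lists_length_le, simp)

lemma increasing_in_lists: "increasing_words q \<subseteq> lists {1..q}"
  by (auto simp: increasing_words_def)

lemma pr_ideal: "x \<in> J \<Longrightarrow> pr x = \<zero>\<^bsub>E\<^esub>"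
  using T.a_rcos_zero[OF J.ideal_axioms] J.zero_closed pr_zero by metis

lemma pr_square_eq_zero:
  assumes "v \<in> carrier T" "\<And>w. v w \<noteq> \<zero> \<Longrightarrow> length w = 1"
  shows "pr v \<otimes>\<^bsub>E\<^esub> pr v = \<zero>\<^bsub>E\<^esub>"
proof -
  have "v \<otimes>\<^bsub>T\<^esub> v \<in> squares" using assms by (auto simp: squares_def)
  then have "v \<otimes>\<^bsub>T\<^esub> v \<in> J"
    unfolding J_def' using T.genideal_self[OF squares_carrier] by blast
  then show ?thesis
    using assms(1) by (simp add: pr_mult[symmetric] pr_ideal)
qed

lemma gen_square: "j \<in> {1..q} \<Longrightarrow> gen j \<otimes>\<^bsub>E\<^esub> gen j = \<zero>\<^bsub>E\<^esub>"
proof (rule pr_square_eq_zero)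
  show "length w = 1" if "mon \<one> [j] w \<noteq> \<zero>" for w
    using that by (auto simp: tensor_monom_def split: if_splits)
qed (intro mon_in_T, auto)

text \<open>
  Polarisation: expand $(\theta^i + \theta^j)^2 = 0$.
\<close>

lemma gen_anticommute:
  assumes "i \<in> {1..q}" "j \<in> {1..q}"
  shows "gen i \<otimes>\<^bsub>E\<^esub> gen j = \<ominus>\<^bsub>E\<^esub> (gen j \<otimes>\<^bsub>E\<^esub> gen i)"
proof -
  have T: "mon \<one> [i] \<in> carrier T" "mon \<one> [j] \<in> carrier T"
    using assms by (auto intro!: mon_in_T)
  note g = gen_closed[OF assms(1)] gen_closed[OF assms(2)]
  let ?v = "mon \<one> [i] \<oplus>\<^bsub>T\<^esub> mon \<one> [j]"
  have "pr ?v \<otimes>\<^bsub>E\<^esub> pr ?v = \<zero>\<^bsub>E\<^esub>"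
  proof (rule pr_square_eq_zero)
    show "?v \<in> carrier T" using T by (rule T.a_closed)
    show "length w = 1" if "?v w \<noteq> \<zero>" for w
      using that by (auto simp: T_simps tensor_monom_def split: if_splits)
  qed
  then have "(gen i \<oplus>\<^bsub>E\<^esub> gen j) \<otimes>\<^bsub>E\<^esub> (gen i \<oplus>\<^bsub>E\<^esub> gen j) = \<zero>\<^bsub>E\<^esub>"
    using T by (simp only: pr_add)
  then have "gen i \<otimes>\<^bsub>E\<^esub> gen j \<oplus>\<^bsub>E\<^esub> gen j \<otimes>\<^bsub>E\<^esub> gen i = \<zero>\<^bsub>E\<^esub>"
    using g by (simp add: E.l_distr E.r_distr gen_square[OF assms(1)] gen_square[OF assms(2)] E.a_comm)
  then show ?thesis
    using g by (intro E.minus_equality[symmetric]) auto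
qed

text \<open>
  One step of insertion sort. A generator is moved to the right past smaller letters, at the cost of a sign
  each time, until it finds its place or meets itself, where the product vanishes. The set of letters
  is recorded so that prepending the skipped letter keeps the word increasing.
\<close>

lemma gen_mult_increasing:
  assumes "j \<in> {1..q}" "w \<in> increasing_words q"
  shows "gen j \<otimes>\<^bsub>E\<^esub> pr (mon \<one> w) = \<zero>\<^bsub>E\<^esub> \<or>
    (\<exists>v\<in>increasing_words q. set v = insert j (set w) \<and> length v = Suc (length w) \<and>
      (gen j \<otimes>\<^bsub>E\<^esub> pr (mon \<one> w) = pr (mon \<one> v) \<or> gen j \<otimes>\<^bsub>E\<^esub> pr (mon \<one> w) = \<ominus>\<^bsub>E\<^esub> pr (mon \<one> v)))"
  using assms(2)
proof (induction w)
  case Nil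
  have "gen j \<otimes>\<^bsub>E\<^esub> pr (mon \<one> []) = pr (mon \<one> [j])"
    using assms(1) by (intro gen_mult_mon) auto
  then show ?case
    using assms(1) by (intro disjI2 bexI[of _ "[j]"]) (auto simp: increasing_words_def)
next
  case (Cons h t)
  have ht: "h \<in> {1..q}" "t \<in> lists {1..q}" "t \<in> increasing_words q" "\<forall>x\<in>set t. h < x"
    using Cons.prems by (auto simp: increasing_words_def)
  have t: "pr (mon \<one> t) \<in> carrier E" using ht by (intro pr_mon_closed) auto
  have h: "gen h \<in> carrier E" and j: "gen j \<in> carrier E" using ht assms by (auto intro: gen_closed)
  have split: "pr (mon \<one> (h # t)) = gen h \<otimes>\<^bsub>E\<^esub> pr (mon \<one> t)"
    using ht by (intro gen_mult_mon[symmetric]) auto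
  consider "j < h" | "j = h" | "h < j" by linarith
  then show ?case
  proof cases
    case 1
    have "gen j \<otimes>\<^bsub>E\<^esub> pr (mon \<one> (h # t)) = pr (mon \<one> (j # h # t))"
      using ht assms(1) by (intro gen_mult_mon) auto
    then show ?thesis
      using 1 Cons.prems assms(1) ht
      by (intro disjI2 bexI[of _ "j # h # t"]) (auto simp: increasing_words_def)
  next
    case 2
    have "gen j \<otimes>\<^bsub>E\<^esub> pr (mon \<one> (h # t)) = (gen j \<otimes>\<^bsub>E\<^esub> gen j) \<otimes>\<^bsub>E\<^esub> pr (mon \<one> t)"
      using 2 h t by (simp add: split E.m_assoc)
    then show ?thesis
      using t by (simp add: gen_square[OF assms(1)])
  next
    case 3
    have swap: "gen j \<otimes>\<^bsub>E\<^esub> pr (mon \<one> (h # t)) = \<ominus>\<^bsub>E\<^esub> (gen h \<otimes>\<^bsub>E\<^esub> (gen j \<otimes>\<^bsub>E\<^esub> pr (mon \<one> t)))"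
    proof -
      have "gen j \<otimes>\<^bsub>E\<^esub> pr (mon \<one> (h # t)) = (gen j \<otimes>\<^bsub>E\<^esub> gen h) \<otimes>\<^bsub>E\<^esub> pr (mon \<one> t)"
        using h j t by (simp add: split E.m_assoc)
      also have "\<dots> = \<ominus>\<^bsub>E\<^esub> (gen h \<otimes>\<^bsub>E\<^esub> (gen j \<otimes>\<^bsub>E\<^esub> pr (mon \<one> t)))"
        unfolding gen_anticommute[OF assms(1) ht(1)] using h j t by (simp add: E.l_minus E.m_assoc)
      finally show ?thesis .
    qed
    from Cons.IH[OF ht(3)] show ?thesis
    proof (elim disjE bexE conjE)
      assume "gen j \<otimes>\<^bsub>E\<^esub> pr (mon \<one> t) = \<zero>\<^bsub>E\<^esub>"
      then show ?thesis using swap h by simp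
    next
      fix v assume v: "v \<in> increasing_words q" "set v = insert j (set t)" "length v = Suc (length t)"
      have hv: "h # v \<in> increasing_words q"
        using v ht 3 by (auto simp: increasing_words_def)
      have vl: "v \<in> lists {1..q}" using v(1) increasing_in_lists by blast
      note M = gen_mult_mon[symmetric, OF one_closed ht(1) vl] pr_mon_closed[OF one_closed vl]
      {
        assume "gen j \<otimes>\<^bsub>E\<^esub> pr (mon \<one> t) = pr (mon \<one> v)"
        then have "gen j \<otimes>\<^bsub>E\<^esub> pr (mon \<one> (h # t)) = \<ominus>\<^bsub>E\<^esub> pr (mon \<one> (h # v))"
          using swap M by simp
        then show ?thesis
          using hv v by (intro disjI2 bexI[of _ "h # v"]) auto
      next
        assume "gen j \<otimes>\<^bsub>E\<^esub> pr (mon \<one> t) = \<ominus>\<^bsub>E\<^esub> pr (mon \<one> v)"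
        then have "gen j \<otimes>\<^bsub>E\<^esub> pr (mon \<one> (h # t)) = pr (mon \<one> (h # v))"
          using swap M h by (simp add: E.r_minus)
        then show ?thesis
          using hv v by (intro disjI2 bexI[of _ "h # v"]) auto
      }
    qed
  qed
qed

lemma monomial_reorder:
  assumes "w \<in> lists {1..q}"
  shows "pr (mon \<one> w) = \<zero>\<^bsub>E\<^esub> \<or> (\<exists>v\<in>increasing_words q. length v = length w \<and>
      (pr (mon \<one> w) = pr (mon \<one> v) \<or> pr (mon \<one> w) = \<ominus>\<^bsub>E\<^esub> pr (mon \<one> v)))"
  using assms
proof (induction w rule: list.induct)
  case Nil
  then show ?case by (intro disjI2 bexI[of _ "[]"]) (auto simp: increasing_words_def)
next
  case (Cons j w)
  have j: "j \<in> {1..q}" and w: "w \<in> lists {1..q}" using Cons.prems by auto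
  have split: "pr (mon \<one> (j # w)) = gen j \<otimes>\<^bsub>E\<^esub> pr (mon \<one> w)"
    by (rule gen_mult_mon[symmetric, OF one_closed j w])
  from Cons.IH[OF w] show ?case
  proof (elim disjE bexE conjE)
    assume "pr (mon \<one> w) = \<zero>\<^bsub>E\<^esub>"
    then show ?thesis using split gen_closed[OF j] by simp
  next
    fix v assume v: "v \<in> increasing_words q" "length v = length w"
    have vc: "pr (mon \<one> v) \<in> carrier E"
      using v(1) increasing_in_lists by (auto intro!: pr_mon_closed)
    {
      assume "pr (mon \<one> w) = pr (mon \<one> v)"
      then show ?thesis
        using gen_mult_increasing[OF j v(1)] v(2) unfolding split by auto
    next
      assume "pr (mon \<one> w) = \<ominus>\<^bsub>E\<^esub> pr (mon \<one> v)"
      then have eq: "pr (mon \<one> (j # w)) = \<ominus>\<^bsub>E\<^esub> (gen j \<otimes>\<^bsub>E\<^esub> pr (mon \<one> v))"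
        using split vc gen_closed[OF j] by (simp add: E.r_minus)
      from gen_mult_increasing[OF j v(1)] show ?thesis
      proof (elim disjE bexE conjE)
        assume "gen j \<otimes>\<^bsub>E\<^esub> pr (mon \<one> v) = \<zero>\<^bsub>E\<^esub>"
        then show ?thesis using eq by simp
      next
        fix u assume u: "u \<in> increasing_words q" "length u = Suc (length v)"
          and "gen j \<otimes>\<^bsub>E\<^esub> pr (mon \<one> v) = pr (mon \<one> u)"
        then show ?thesis using eq v(2) by (intro disjI2 bexI[of _ u]) auto
      next
        fix u assume u: "u \<in> increasing_words q" "length u = Suc (length v)"
          and m: "gen j \<otimes>\<^bsub>E\<^esub> pr (mon \<one> v) = \<ominus>\<^bsub>E\<^esub> pr (mon \<one> u)"
        have "pr (mon \<one> u) \<in> carrier E"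
          using u(1) increasing_in_lists by (auto intro!: pr_mon_closed)
        then have "pr (mon \<one> (j # w)) = pr (mon \<one> u)"
          using eq m by simp
        then show ?thesis using u v(2) by (intro disjI2 bexI[of _ u]) auto
      qed
    }
  qed
qed

text \<open>
  The elements represented by a tensor supported on words with length in \<open>L\<close>. For \<open>L\<close> a singleton these are
  the homogeneous elements, for \<open>L\<close> a residue class modulo 2 those of pure parity.
\<close>

definition graded where
  "graded L = (\<lambda>x. pr x) ` {x \<in> carrier T. \<forall>w. x w \<noteq> \<zero> \<longrightarrow> length w \<in> L}"

text \<open>
  The words in the span are increasing, whereas those in \<open>graded\<close> are arbitrary. Reordering preserves the
  length, so both describe the same elements.
\<close>

lemma ext_span_graded: "ext_span R q {w \<in> increasing_words q. length w \<in> L} = graded L"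
proof -
  let ?W = "{w \<in> increasing_words q. length w \<in> L}"
  have W: "finite ?W" "?W \<subseteq> lists {1..q}"
    using finite_increasing_words increasing_in_lists by auto
  let ?S = "(\<lambda>x. pr x) ` {x \<in> carrier T. \<forall>w. x w \<noteq> \<zero> \<longrightarrow> w \<in> ?W}"
  have zero: "\<zero>\<^bsub>E\<^esub> \<in> ?S"
    unfolding pr_zero[symmetric] by (intro imageI CollectI conjI) (simp_all add: T_simps zero_in_T)
  have add: "a \<oplus>\<^bsub>E\<^esub> b \<in> ?S" if a: "a \<in> ?S" and b: "b \<in> ?S" for a b
  proof -
    obtain x where x: "x \<in> carrier T" "\<And>w. x w \<noteq> \<zero> \<Longrightarrow> w \<in> ?W" "a = pr x" using a by blast
    obtain y where y: "y \<in> carrier T" "\<And>w. y w \<noteq> \<zero> \<Longrightarrow> w \<in> ?W" "b = pr y" using b by blast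
    have "w \<in> ?W" if "(x \<oplus>\<^bsub>T\<^esub> y) w \<noteq> \<zero>" for w
    proof (rule ccontr)
      assume "w \<notin> ?W"
      then have "x w = \<zero>" "y w = \<zero>" using x(2) y(2) by blast+
      then show False using that by (simp add: T_simps)
    qed
    then show ?thesis
      unfolding x(3) y(3) pr_add[OF x(1) y(1), symmetric] using x(1) y(1) by (intro imageI CollectI conjI) auto
  qed
  have "graded L \<subseteq> ?S"
  proof
    fix a assume "a \<in> graded L"
    then obtain x where x: "x \<in> carrier T" "{w. x w \<noteq> \<zero>} \<subseteq> {w. length w \<in> L}" and a: "a = pr x"
      by (auto simp: graded_def)
    show "a \<in> ?S"
      unfolding a using x
    proof (induction rule: tensor_induct)
      case zero
      then show ?case using \<open>\<zero>\<^bsub>E\<^esub> \<in> ?S\<close> pr_zero by simp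
    next
      case (add x y)
      then show ?case using \<open>\<And>a b. \<lbrakk>a \<in> ?S; b \<in> ?S\<rbrakk> \<Longrightarrow> a \<oplus>\<^bsub>E\<^esub> b \<in> ?S\<close> by (simp only: pr_add)
    next
      case (mon c w)
      have cl: "pr (mon c []) \<in> carrier E" using mon by (intro pr_mon_closed) auto
      have eq: "pr (mon c w) = pr (mon c []) \<otimes>\<^bsub>E\<^esub> pr (mon \<one> w)"
        using pr_mon_mult[of c \<one> "[]" w] mon by simp
      from monomial_reorder[OF mon(2)] show ?case
      proof (elim disjE bexE conjE)
        assume "pr (mon \<one> w) = \<zero>\<^bsub>E\<^esub>"
        then show ?thesis using eq cl zero by simp
      next
        fix v assume v: "v \<in> increasing_words q" "length v = length w"
        have vl: "v \<in> lists {1..q}" using v(1) increasing_in_lists by blast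
        have supp: "mon c v u \<noteq> \<zero> \<Longrightarrow> u \<in> ?W" for u
          using v mon(3) by (auto simp: tensor_monom_def split: if_splits)
        have cv: "pr (mon c v) = pr (mon c []) \<otimes>\<^bsub>E\<^esub> pr (mon \<one> v)"
          using pr_mon_mult[of c \<one> "[]" v] mon(1) vl by simp
        {
          assume "pr (mon \<one> w) = pr (mon \<one> v)"
          then have "pr (mon c w) = pr (mon c v)" using eq cv by simp
          then show ?thesis
            using supp mon_in_T[OF mon(1) vl] by auto
        next
          assume "pr (mon \<one> w) = \<ominus>\<^bsub>E\<^esub> pr (mon \<one> v)"
          then have "pr (mon c w) = \<ominus>\<^bsub>E\<^esub> pr (mon c v)"
            using eq cv cl pr_mon_closed[OF one_closed vl] by (simp add: E.r_minus)
          also have "\<dots> = pr (\<ominus>\<^bsub>T\<^esub> mon c v)"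
            using mon_in_T[OF mon(1) vl] by (simp only: pr_uminus)
          finally have e: "pr (mon c w) = pr (\<ominus>\<^bsub>T\<^esub> mon c v)" .
          have "(\<ominus>\<^bsub>T\<^esub> mon c v) u \<noteq> \<zero> \<Longrightarrow> u \<in> ?W" for u
            using supp[of u] mon_in_T[OF mon(1) vl] by (cases "mon c v u = \<zero>") (auto simp: T_uminus)
          then show ?thesis
            unfolding e using mon_in_T[OF mon(1) vl] by (intro imageI CollectI conjI) auto
        }
      qed
    qed
  qed
  moreover have "?S \<subseteq> graded L" by (auto simp: graded_def)
  ultimately show ?thesis using ext_span_eq[OF W] by simp
qed

lemma ext_homogeneous_eq: "ext_homogeneous R q k = graded {k}"
  using ext_span_graded[of "{k}"] by (simp add: ext_homogeneous_def)

lemma ext_parity_eq: "ext_parity R q p = graded {n. n mod 2 = p mod 2}"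
  using ext_span_graded[of "{n. n mod 2 = p mod 2}"] by (simp add: ext_parity_def)

lemma graded_in_carrier: "graded L \<subseteq> carrier E"
  by (auto simp: graded_def)

end


section \<open>Contraction and the Euler operator on the exterior algebra\<close>

context free_exterior
begin

lemma contract_pr_cong:
  assumes "x \<in> carrier T" "y \<in> carrier T" "pr x = pr y"
  shows "pr (contract i x) = pr (contract i y)"
proof -
  have d: "x \<ominus>\<^bsub>T\<^esub> y \<in> J" by (rule iffD1[OF pr_eq_iff[OF assms(1,2)] assms(3)])
  then have "pr (contract i (x \<ominus>\<^bsub>T\<^esub> y)) = \<zero>\<^bsub>E\<^esub>"
    by (intro pr_ideal contract_ideal)
  moreover have "contract i x = contract i ((x \<ominus>\<^bsub>T\<^esub> y) \<oplus>\<^bsub>T\<^esub> y)"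
    using assms(1,2) by (simp add: T.minus_eq T.a_assoc T.l_neg)
  then have "contract i x = contract i (x \<ominus>\<^bsub>T\<^esub> y) \<oplus>\<^bsub>T\<^esub> contract i y"
    using assms(1,2) by (simp only: contract_T_add T.minus_closed)
  then have "pr (contract i x) = pr (contract i (x \<ominus>\<^bsub>T\<^esub> y)) \<oplus>\<^bsub>E\<^esub> pr (contract i y)"
    using assms(1,2) by (simp add: pr_add contract_in_T)
  ultimately show ?thesis
    using assms(2) by (simp add: contract_in_T)
qed

text \<open>
  The map induced by contraction on the quotient, evaluated through an arbitrary representative and
  extensional outside the carrier.
\<close>

definition ext_contract where
  "ext_contract i = (\<lambda>a\<in>carrier E. pr (contract i (SOME x. x \<in> carrier T \<and> pr x = a)))"

lemma ext_contract_pr: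
  assumes "x \<in> carrier T"
  shows "ext_contract i (pr x) = pr (contract i x)"
proof -
  define y where "y = (SOME y. y \<in> carrier T \<and> pr y = pr x)"
  have "y \<in> carrier T \<and> pr y = pr x"
    unfolding y_def by (rule someI[of "\<lambda>y. y \<in> carrier T \<and> pr y = pr x" x]) (simp add: assms)
  moreover from this have "pr (contract i y) = pr (contract i x)"
    by (intro contract_pr_cong assms) auto
  ultimately show ?thesis
    using assms by (simp add: ext_contract_def y_def)
qed

lemma pr_cases: "a \<in> carrier E \<Longrightarrow> (\<And>x. x \<in> carrier T \<Longrightarrow> a = pr x \<Longrightarrow> P) \<Longrightarrow> P"
  unfolding pr_surj by blast

lemma ext_contract_closed: "a \<in> carrier E \<Longrightarrow> ext_contract i a \<in> carrier E"
  by (erule pr_cases) (simp add: ext_contract_pr contract_in_T)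

lemma ext_contract_add:
  "a \<in> carrier E \<Longrightarrow> b \<in> carrier E \<Longrightarrow>
    ext_contract i (a \<oplus>\<^bsub>E\<^esub> b) = ext_contract i a \<oplus>\<^bsub>E\<^esub> ext_contract i b"
  by (elim pr_cases) (simp add: ext_contract_pr contract_in_T contract_T_add pr_add[symmetric])

lemma ext_contract_leibniz:
  assumes "a \<in> graded L" "b \<in> carrier E" "\<And>n. n \<in> L \<Longrightarrow> n mod 2 = p mod 2"
  shows "ext_contract i (a \<otimes>\<^bsub>E\<^esub> b) = ext_contract i a \<otimes>\<^bsub>E\<^esub> b
     \<oplus>\<^bsub>E\<^esub> (if even p then a \<otimes>\<^bsub>E\<^esub> ext_contract i b else \<ominus>\<^bsub>E\<^esub> (a \<otimes>\<^bsub>E\<^esub> ext_contract i b))"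
proof -
  obtain x where x: "x \<in> carrier T" "a = pr x" "\<And>w. x w \<noteq> \<zero> \<Longrightarrow> length w \<in> L"
    using assms(1) by (auto simp: graded_def)
  obtain y where y: "y \<in> carrier T" "b = pr y"
    using assms(2) by (rule pr_cases)
  have inv: "invol x = (if even p then x else \<ominus>\<^bsub>T\<^esub> x)"
    using x assms(3) by (intro invol_parity) auto
  have "ext_contract i (a \<otimes>\<^bsub>E\<^esub> b) = pr (contract i x \<otimes>\<^bsub>T\<^esub> y \<oplus>\<^bsub>T\<^esub> invol x \<otimes>\<^bsub>T\<^esub> contract i y)"
    using x(1) y(1) unfolding x(2) y(2)
    by (simp add: pr_mult[symmetric] ext_contract_pr contract_T_mult)
  also have "\<dots> = pr (contract i x) \<otimes>\<^bsub>E\<^esub> pr y \<oplus>\<^bsub>E\<^esub> pr (invol x) \<otimes>\<^bsub>E\<^esub> pr (contract i y)"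
    using x(1) y(1) by (simp add: pr_mult pr_add contract_in_T invol_in_T)
  finally show ?thesis
    using x(1) y(1) unfolding x(2) y(2) inv
    by (auto simp: ext_contract_pr pr_uminus contract_in_T E.l_minus)
qed

lemma contract_scalar: "contract i (mon c []) = \<zero>\<^bsub>T\<^esub>"
proof
  show "contract i (mon c []) w = \<zero>\<^bsub>T\<^esub> w" for w
    by (cases w) (auto simp: T_simps monom_Cons_shift, auto simp: tensor_monom_def minus_eq)
qed

lemma contract_gen: "contract i (mon \<one> [j]) = (if i = j then \<one>\<^bsub>T\<^esub> else \<zero>\<^bsub>T\<^esub>)"
proof
  show "contract i (mon \<one> [j]) w = (if i = j then \<one>\<^bsub>T\<^esub> else \<zero>\<^bsub>T\<^esub>) w" for w
  proof (cases w)
    case Nil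
    then show ?thesis by (simp add: T_simps) (simp add: tensor_monom_def)
  next
    case (Cons a v)
    have "contract i (\<lambda>u. mon \<one> [j] (a # u)) v = \<zero>"
      by (simp add: monom_Cons_shift contract_scalar) (simp add: T_simps)
    then show ?thesis
      by (simp add: Cons T_simps) (simp add: tensor_monom_def minus_eq)
  qed
qed

lemma ext_contract_scalar: "c \<in> carrier R \<Longrightarrow> ext_contract i (ext_scalar R q c) = \<zero>\<^bsub>E\<^esub>"
  unfolding ext_scalar_def by (subst ext_contract_pr) (auto simp: mon_in_T contract_scalar pr_zero)

lemma ext_contract_gen:
  "j \<in> {1..q} \<Longrightarrow> ext_contract i (gen j) = (if i = j then \<one>\<^bsub>E\<^esub> else \<zero>\<^bsub>E\<^esub>)"
  by (subst ext_contract_pr) (auto simp: mon_in_T contract_gen pr_zero pr_one)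

lemma gen_in_graded: "j \<in> {1..q} \<Longrightarrow> gen j \<in> graded {1}"
  unfolding graded_def
  by (intro imageI CollectI conjI mon_in_T) (auto simp: tensor_monom_def)

lemma ext_contract_graded:
  assumes "a \<in> graded L" "\<And>n. Suc n \<in> L \<Longrightarrow> n \<in> M"
  shows "ext_contract i a \<in> graded M"
proof -
  obtain x where x: "x \<in> carrier T" "a = pr x" "\<And>w. x w \<noteq> \<zero> \<Longrightarrow> length w \<in> L"
    using assms(1) by (auto simp: graded_def)
  have "length w \<in> M" if nz: "contract i x w \<noteq> \<zero>" for w
  proof -
    obtain u v where "w = u @ v" "x (u @ i # v) \<noteq> \<zero>"
      using contract_support[of x i w] x(1) nz by auto
    then show ?thesis using x(3)[of "u @ i # v"] assms(2) by simp
  qed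
  then show ?thesis
    using x(1,2) by (auto simp: graded_def ext_contract_pr contract_in_T)
qed

definition ext_euler where
  "ext_euler a = (\<Oplus>\<^bsub>E\<^esub>i\<in>{1..q}. gen i \<otimes>\<^bsub>E\<^esub> ext_contract i a)"

lemma ext_euler_add:
  assumes "a \<in> carrier E" "b \<in> carrier E"
  shows "ext_euler (a \<oplus>\<^bsub>E\<^esub> b) = ext_euler a \<oplus>\<^bsub>E\<^esub> ext_euler b"
proof -
  have "ext_euler (a \<oplus>\<^bsub>E\<^esub> b) =
      (\<Oplus>\<^bsub>E\<^esub>i\<in>{1..q}. gen i \<otimes>\<^bsub>E\<^esub> ext_contract i a \<oplus>\<^bsub>E\<^esub> gen i \<otimes>\<^bsub>E\<^esub> ext_contract i b)"
    unfolding ext_euler_def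
    by (rule E.finsum_cong')
      (auto simp: assms ext_contract_add E.r_distr gen_closed ext_contract_closed)
  also have "\<dots> = ext_euler a \<oplus>\<^bsub>E\<^esub> ext_euler b"
    unfolding ext_euler_def
    by (rule E.finsum_addf) (auto simp: assms gen_closed ext_contract_closed)
  finally show ?thesis .
qed

lemma ext_euler_zero: "(\<And>i. ext_contract i a = \<zero>\<^bsub>E\<^esub>) \<Longrightarrow> ext_euler a = \<zero>\<^bsub>E\<^esub>"
  unfolding ext_euler_def by (intro E.add.finprod_one_eqI) (auto simp: gen_closed)

text \<open>
  By the Leibniz rule and anticommutativity,
  $\theta^i\partial_i(\theta^j s) = \delta_{ij}\,\theta^i s - \theta^i\theta^j\partial_i(s)
  = \delta_{ij}\,\theta^i s + \theta^j\theta^i\partial_i(s)$: the two signs cancel, and \<open>ext_euler\<close> behaves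
  like an even derivation under multiplication by a generator.
\<close>

lemma ext_euler_gen_mult:
  assumes j: "j \<in> {1..q}" and s: "s \<in> carrier E"
  shows "ext_euler (gen j \<otimes>\<^bsub>E\<^esub> s) = gen j \<otimes>\<^bsub>E\<^esub> s \<oplus>\<^bsub>E\<^esub> gen j \<otimes>\<^bsub>E\<^esub> ext_euler s"
proof -
  have gj: "gen j \<in> carrier E" by (rule gen_closed[OF j])
  have summand: "gen i \<otimes>\<^bsub>E\<^esub> ext_contract i (gen j \<otimes>\<^bsub>E\<^esub> s) =
      (if j = i then gen i \<otimes>\<^bsub>E\<^esub> s else \<zero>\<^bsub>E\<^esub>) \<oplus>\<^bsub>E\<^esub> gen j \<otimes>\<^bsub>E\<^esub> (gen i \<otimes>\<^bsub>E\<^esub> ext_contract i s)"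
    if i: "i \<in> {1..q}" for i
  proof -
    define t where "t = ext_contract i s"
    have gi: "gen i \<in> carrier E" and t: "t \<in> carrier E"
      using gen_closed[OF i] ext_contract_closed[OF s] by (auto simp: t_def)
    have "ext_contract i (gen j \<otimes>\<^bsub>E\<^esub> s) = (if j = i then s else \<zero>\<^bsub>E\<^esub>) \<oplus>\<^bsub>E\<^esub> \<ominus>\<^bsub>E\<^esub> (gen j \<otimes>\<^bsub>E\<^esub> t)"
      using ext_contract_leibniz[OF gen_in_graded[OF j] s, of 1] s
      by (auto simp: ext_contract_gen[OF j] t_def)
    then have "gen i \<otimes>\<^bsub>E\<^esub> ext_contract i (gen j \<otimes>\<^bsub>E\<^esub> s) =
        (if j = i then gen i \<otimes>\<^bsub>E\<^esub> s else \<zero>\<^bsub>E\<^esub>) \<oplus>\<^bsub>E\<^esub> \<ominus>\<^bsub>E\<^esub> ((gen i \<otimes>\<^bsub>E\<^esub> gen j) \<otimes>\<^bsub>E\<^esub> t)"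
      using gi gj t s by (auto simp: E.r_distr E.r_minus E.m_assoc)
    also have "\<ominus>\<^bsub>E\<^esub> ((gen i \<otimes>\<^bsub>E\<^esub> gen j) \<otimes>\<^bsub>E\<^esub> t) = gen j \<otimes>\<^bsub>E\<^esub> (gen i \<otimes>\<^bsub>E\<^esub> t)"
      unfolding gen_anticommute[OF i j] using gi gj t by (simp add: E.l_minus E.m_assoc)
    finally show ?thesis by (simp add: t_def)
  qed
  have "ext_euler (gen j \<otimes>\<^bsub>E\<^esub> s) = (\<Oplus>\<^bsub>E\<^esub>i\<in>{1..q}.
      (if j = i then gen i \<otimes>\<^bsub>E\<^esub> s else \<zero>\<^bsub>E\<^esub>) \<oplus>\<^bsub>E\<^esub> gen j \<otimes>\<^bsub>E\<^esub> (gen i \<otimes>\<^bsub>E\<^esub> ext_contract i s))"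
    unfolding ext_euler_def
    by (rule E.finsum_cong') (auto simp: summand s gj gen_closed ext_contract_closed)
  also have "\<dots> = (\<Oplus>\<^bsub>E\<^esub>i\<in>{1..q}. if j = i then gen i \<otimes>\<^bsub>E\<^esub> s else \<zero>\<^bsub>E\<^esub>) \<oplus>\<^bsub>E\<^esub>
      (\<Oplus>\<^bsub>E\<^esub>i\<in>{1..q}. gen j \<otimes>\<^bsub>E\<^esub> (gen i \<otimes>\<^bsub>E\<^esub> ext_contract i s))"
    by (rule E.finsum_addf) (auto simp: s gj gen_closed ext_contract_closed)
  also have "(\<Oplus>\<^bsub>E\<^esub>i\<in>{1..q}. if j = i then gen i \<otimes>\<^bsub>E\<^esub> s else \<zero>\<^bsub>E\<^esub>) = gen j \<otimes>\<^bsub>E\<^esub> s"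
    by (rule E.add.finprod_singleton) (use j s gen_closed in auto)
  also have "(\<Oplus>\<^bsub>E\<^esub>i\<in>{1..q}. gen j \<otimes>\<^bsub>E\<^esub> (gen i \<otimes>\<^bsub>E\<^esub> ext_contract i s)) = gen j \<otimes>\<^bsub>E\<^esub> ext_euler s"
    unfolding ext_euler_def
    by (rule E.finsum_rdistr[symmetric]) (auto simp: s gj gen_closed ext_contract_closed)
  finally show ?thesis .
qed

lemma ext_euler_monomial:
  assumes "c \<in> carrier R" "w \<in> lists {1..q}"
  shows "ext_euler (pr (mon c w)) = [length w] \<cdot>\<^bsub>E\<^esub> pr (mon c w)"
  using assms(2)
proof (induction w rule: list.induct)
  case Nil
  have "ext_contract i (pr (mon c [])) = \<zero>\<^bsub>E\<^esub>" for i
    using ext_contract_scalar[OF assms(1)] by (simp add: ext_scalar_def)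
  then show ?case by (simp add: ext_euler_zero)
next
  case (Cons j w)
  have j: "j \<in> {1..q}" and w: "w \<in> lists {1..q}" using Cons.prems by auto
  define s where "s = pr (mon c w)"
  have s: "s \<in> carrier E" unfolding s_def by (rule pr_mon_closed[OF assms(1) w])
  have split: "pr (mon c (j # w)) = gen j \<otimes>\<^bsub>E\<^esub> s"
    unfolding s_def by (rule gen_mult_mon[symmetric, OF assms(1) j w])
  have "ext_euler (gen j \<otimes>\<^bsub>E\<^esub> s) = gen j \<otimes>\<^bsub>E\<^esub> s \<oplus>\<^bsub>E\<^esub> gen j \<otimes>\<^bsub>E\<^esub> ([length w] \<cdot>\<^bsub>E\<^esub> s)"
    using ext_euler_gen_mult[OF j s] Cons.IH[OF w] by (simp add: s_def)
  also have "\<dots> = [Suc (length w)] \<cdot>\<^bsub>E\<^esub> (gen j \<otimes>\<^bsub>E\<^esub> s)"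
    using gen_closed[OF j] s by (simp add: E.add_pow_rdistr E.add.nat_pow_Suc E.a_comm)
  finally show ?case by (simp add: split)
qed

lemma ext_euler_graded:
  assumes "a \<in> graded {k}"
  shows "ext_euler a = [k] \<cdot>\<^bsub>E\<^esub> a"
proof -
  obtain x where x: "x \<in> carrier T" "{w. x w \<noteq> \<zero>} \<subseteq> {w. length w = k}" and a: "a = pr x"
    using assms by (auto simp: graded_def)
  show ?thesis
    unfolding a using x
  proof (induction rule: tensor_induct)
    case zero
    have "ext_contract i (pr \<zero>\<^bsub>T\<^esub>) = \<zero>\<^bsub>E\<^esub>" for i
    proof -
      have "contract i \<zero>\<^bsub>T\<^esub> = \<zero>\<^bsub>T\<^esub>" by (simp add: T_simps fun_eq_iff)
      then show ?thesis using ext_contract_pr[OF T.zero_closed, of i] pr_zero by simp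
    qed
    then have "ext_euler (pr \<zero>\<^bsub>T\<^esub>) = \<zero>\<^bsub>E\<^esub>" by (rule ext_euler_zero)
    then show ?case by (simp add: pr_zero)
  next
    case (mon c w)
    then show ?case using ext_euler_monomial[of c w] by simp
  next
    case (add x y)
    then show ?case by (simp add: pr_add ext_euler_add E.add.nat_pow_distrib)
  qed
qed

end


section \<open>Superderivations and the Euler vector field\<close>

locale split_cinf_superring = cinf_ring C for C :: "'a cinf_ring" +
  fixes q :: nat
begin

sublocale free_exterior K q
  unfolding free_exterior_def by (rule cring_underlying_ring)

lemma split_superring_eq: "split_superring C q = E"
  by (simp add: split_superring_def)

lemma sign_smult:
  assumes "a \<in> carrier E"
  shows "[((- 1) ^ p :: int)] \<cdot>\<^bsub>E\<^esub> a = (if even p then a else \<ominus>\<^bsub>E\<^esub> a)"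
proof (cases "even p")
  case True
  then show ?thesis using assms by (simp add: add_pow_int_ge)
next
  case False
  then show ?thesis using assms by (simp add: add_pow_int_lt)
qed

lemma superderivation_contract: "superderivation C q 1 (ext_contract i)"
  unfolding superderivation_def Let_def split_superring_eq
proof (intro conjI allI ballI)
  show "ext_contract i \<in> carrier E \<rightarrow>\<^sub>E carrier E"
    by (intro PiE_I) (simp add: ext_contract_closed, simp add: ext_contract_def)
next
  fix r s assume "r \<in> carrier E" "s \<in> carrier E"
  then show "ext_contract i (r \<oplus>\<^bsub>E\<^esub> s) = ext_contract i r \<oplus>\<^bsub>E\<^esub> ext_contract i s"
    by (rule ext_contract_add)
next
  fix t r assume r: "r \<in> carrier E"
  let ?c = "ext_scalar K q (cinf_const C t)"
  have c: "?c \<in> graded {0}"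
    unfolding graded_def ext_scalar_def using const_closed
    by (intro imageI CollectI conjI mon_in_T) (auto simp: tensor_monom_def)
  then have cE: "?c \<in> carrier E" using graded_in_carrier by blast
  have "ext_contract i (?c \<otimes>\<^bsub>E\<^esub> r) = ext_contract i ?c \<otimes>\<^bsub>E\<^esub> r \<oplus>\<^bsub>E\<^esub> ?c \<otimes>\<^bsub>E\<^esub> ext_contract i r"
    using ext_contract_leibniz[OF c r, of 0] by simp
  then show "ext_contract i (?c \<otimes>\<^bsub>E\<^esub> r) = ?c \<otimes>\<^bsub>E\<^esub> ext_contract i r"
    using cE r by (simp add: ext_contract_scalar const_closed ext_contract_closed)
next
  fix p r assume "r \<in> ext_parity K q p"
  then have r: "r \<in> graded {n. n mod 2 = p mod 2}" by (simp add: ext_parity_eq)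
  show "ext_contract i r \<in> ext_parity K q (1 + p)"
    unfolding ext_parity_eq
  proof (rule ext_contract_graded[OF r])
    fix n :: nat assume "Suc n \<in> {n. n mod 2 = p mod 2}"
    then show "n \<in> {n. n mod 2 = (1 + p) mod 2}" by simp presburger
  qed
next
  fix p p' r s assume "r \<in> ext_parity K q p" "s \<in> ext_parity K q p'"
  then have r: "r \<in> graded {n. n mod 2 = p mod 2}" and "s \<in> graded {n. n mod 2 = p' mod 2}"
    by (simp_all add: ext_parity_eq)
  then have s: "s \<in> carrier E" and rE: "r \<in> carrier E" using graded_in_carrier by blast+
  show "ext_contract i (r \<otimes>\<^bsub>E\<^esub> s) = ext_contract i r \<otimes>\<^bsub>E\<^esub> s \<oplus>\<^bsub>E\<^esub>
      [((- 1) ^ (1 * p) :: int)] \<cdot>\<^bsub>E\<^esub> (r \<otimes>\<^bsub>E\<^esub> ext_contract i s)"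
    using ext_contract_leibniz[OF r s, of p i] s rE by (simp add: sign_smult ext_contract_closed)
qed

lemma monomial_parity:
  "c \<in> carrier K \<Longrightarrow> w \<in> lists {1..q} \<Longrightarrow> pr (mon c w) \<in> ext_parity K q (length w)"
  unfolding ext_parity_eq graded_def
  by (intro imageI CollectI conjI mon_in_T) (auto simp: tensor_monom_def)

lemma superderivation_funcset: "superderivation C q d D \<Longrightarrow> D \<in> carrier E \<rightarrow>\<^sub>E carrier E"
  unfolding superderivation_def Let_def split_superring_eq by (elim conjE)

lemma superderivation_add:
  assumes "superderivation C q d D" "r \<in> carrier E" "s \<in> carrier E"
  shows "D (r \<oplus>\<^bsub>E\<^esub> s) = D r \<oplus>\<^bsub>E\<^esub> D s"
proof -
  have "\<forall>r\<in>carrier E. \<forall>s\<in>carrier E. D (r \<oplus>\<^bsub>E\<^esub> s) = D r \<oplus>\<^bsub>E\<^esub> D s"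
    using assms(1) unfolding superderivation_def Let_def split_superring_eq by (elim conjE)
  then show ?thesis using assms(2,3) by simp
qed

lemma superderivation_leibniz:
  assumes "superderivation C q d D" "r \<in> ext_parity K q p" "s \<in> ext_parity K q p'"
  shows "D (r \<otimes>\<^bsub>E\<^esub> s) = D r \<otimes>\<^bsub>E\<^esub> s \<oplus>\<^bsub>E\<^esub> [((- 1) ^ (d * p) :: int)] \<cdot>\<^bsub>E\<^esub> (r \<otimes>\<^bsub>E\<^esub> D s)"
proof -
  have "\<forall>p p'. \<forall>r\<in>ext_parity K q p. \<forall>s\<in>ext_parity K q p'.
      D (r \<otimes>\<^bsub>E\<^esub> s) = D r \<otimes>\<^bsub>E\<^esub> s \<oplus>\<^bsub>E\<^esub> [((- 1) ^ (d * p) :: int)] \<cdot>\<^bsub>E\<^esub> (r \<otimes>\<^bsub>E\<^esub> D s)"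
    using assms(1) unfolding superderivation_def Let_def split_superring_eq by (elim conjE)
  from bspec[OF bspec[OF spec[OF spec[OF this]] assms(2)] assms(3)] show ?thesis .
qed

text \<open>
  The Leibniz rule expresses the value on $c\,\theta^j\theta^w$ through the values on $\theta^j$ and on
  $c\,\theta^w$. It is stated for factors of pure parity only, which is why the parity of monomials on
  arbitrary words has to be known.
\<close>

lemma superderivation_eqI:
  assumes D: "superderivation C q d D" and D': "superderivation C q d D'"
    and scalar: "\<And>c. c \<in> carrier C \<Longrightarrow> D (ext_scalar K q c) = D' (ext_scalar K q c)"
    and gens: "\<And>j. j \<in> {1..q} \<Longrightarrow> D (ext_gen K q j) = D' (ext_gen K q j)"
  shows "D = D'"
proof (rule PiE_ext)
  show "D \<in> carrier E \<rightarrow>\<^sub>E carrier E" "D' \<in> carrier E \<rightarrow>\<^sub>E carrier E"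
    using D D' by (simp_all only: superderivation_funcset)
  have scal: "D (pr (mon c [])) = D' (pr (mon c []))" if "c \<in> carrier K" for c
    using scalar[of c] that by (simp add: ext_scalar_def carrier_underlying)
  have monomial: "D (pr (mon c w)) = D' (pr (mon c w))" if c: "c \<in> carrier K" and "w \<in> lists {1..q}" for c w
    using that(2)
  proof (induction w rule: list.induct)
    case Nil
    show ?case by (rule scal[OF c])
  next
    case (Cons j w)
    then have j: "j \<in> {1..q}" and w: "w \<in> lists {1..q}" by auto
    have parity: "gen j \<in> ext_parity K q 1" "pr (mon c w) \<in> ext_parity K q (length w)"
      using monomial_parity[OF one_closed, of "[j]"] monomial_parity[OF c w] j by simp_all
    have "D (gen j) = D' (gen j)"
      using gens[OF j] by (simp add: ext_gen_def)
    then show ?case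
      using superderivation_leibniz[OF D parity] superderivation_leibniz[OF D' parity] Cons.IH[OF w]
      by (simp add: gen_mult_mon[OF c j w])
  qed
  show "D a = D' a" if aE: "a \<in> carrier E" for a
  proof -
    from aE obtain x where x: "x \<in> carrier T" and a: "a = pr x" by (rule pr_cases)
    show ?thesis
      unfolding a using x subset_UNIV[of "{w. x w \<noteq> \<zero>\<^bsub>K\<^esub>}"]
    proof (induction rule: tensor_induct)
      case zero
      have "mon \<zero>\<^bsub>K\<^esub> [] = \<zero>\<^bsub>T\<^esub>" by (auto simp: T_simps tensor_monom_def)
      then show ?case using scal[OF zero_closed] by simp
    next
      case (mon c w)
      then show ?case by (intro monomial)
    next
      case (add x y)
      then show ?case by (simp add: pr_add superderivation_add[OF D] superderivation_add[OF D'])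
    qed
  qed
qed

text \<open>
  Contraction is a superderivation with the prescribed values, and these values determine it.
\<close>

lemma ext_partial_eq: "ext_partial C q i = ext_contract i"
  unfolding ext_partial_def split_superring_eq
proof (rule the_equality)
  show contract: "superderivation C q 1 (ext_contract i) \<and>
     (\<forall>c\<in>carrier C. ext_contract i (ext_scalar K q c) = \<zero>\<^bsub>E\<^esub>) \<and>
     (\<forall>j\<in>{1..q}. ext_contract i (ext_gen K q j) = (if j = i then \<one>\<^bsub>E\<^esub> else \<zero>\<^bsub>E\<^esub>))"
    by (intro conjI ballI superderivation_contract)
      (auto simp: ext_contract_scalar carrier_underlying ext_gen_def ext_contract_gen)
  show "D = ext_contract i"
    if D: "superderivation C q 1 D \<and> (\<forall>c\<in>carrier C. D (ext_scalar K q c) = \<zero>\<^bsub>E\<^esub>) \<and>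
     (\<forall>j\<in>{1..q}. D (ext_gen K q j) = (if j = i then \<one>\<^bsub>E\<^esub> else \<zero>\<^bsub>E\<^esub>))" for D
    by (rule superderivation_eqI[of 1]) (use D contract in auto)
qed

lemma euler_field_eq: "euler_field C q a = ext_euler a"
  by (simp add: euler_field_def ext_euler_def ext_gen_def split_superring_eq ext_partial_eq)

end

theorem proposition3p43:
  fixes C :: "'a cinf_ring" and q k :: nat and a :: "(nat list \<Rightarrow> 'a) set"
  assumes "cinf_ring C"
    and "a \<in> ext_homogeneous (underlying_ring C) q k"
  shows "euler_field C q a = [k] \<cdot>\<^bsub>split_superring C q\<^esub> a"
proof -
  interpret split_cinf_superring C q
    using assms(1) by (rule split_cinf_superring.intro)
  show ?thesis
    using assms(2)
    by (simp add: ext_homogeneous_eq ext_euler_graded euler_field_eq split_superring_eq)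
qed

end
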